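(* For any $q>1$ we have \[ \mathcal{H}^{\dim_H E_q}\bigl(\mathcal{U}_q^{(2^{\aleph_0})}\bigr)=\mathcal{H}^{\dim_H E_q}(E_q)\in(0,\infty). \]
   Context: For a real number $q>1$, a $q$-expansion of a real number $x$ is an infinite sequence $(d_i)_{i\ge1}$ with $d_i\in\{0,1,q\}$ for all $i\ge 1$ and $x=\sum_{i=1}^\infty d_i/q^i$ (the digit set depends on $q$). Let $E_q$ be the set of real numbers having at least one $q$-expansion, and let $\mathcal{U}_q^{(2^{\aleph_0})}$ be the set of all $x\in E_q$ whose set of $q$-expansions has cardinality $2^{\aleph_0}$. $\dim_H$ denotes Hausdorff dimension and $\mathcal{H}^s$ denotes $s$-dimensional Hausdorff measure. *)

theory Defs
  imports "HOL-Analysis.Analysis" "HOL-Library.Equipollence"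
begin

(* The s-th power of the diameter of a bounded set, with the conventions diam({})^s = 0 and
   0^0 = 1 on nonempty sets (so that the 0-dimensional measure is counting measure; the
   library has 0 powr 0 = 0). *)
definition diam_powr :: "real \<Rightarrow> 'a::metric_space set \<Rightarrow> ennreal" where
  "diam_powr s U =
     (if U = {} then 0 else if s = 0 then 1 else ennreal (diameter U powr s))"

(* Boundedness is required because the library's real-valued diameter is unspecified on
   unbounded sets.  Finite covers are included, as U i may be empty.  No normalising constant
   is used. *)
definition hausdorff_pre_measure :: "real \<Rightarrow> real \<Rightarrow> 'a::metric_space set \<Rightarrow> ennreal" where
  "hausdorff_pre_measure s \<delta> A =
     (INF U \<in> {U :: nat \<Rightarrow> 'a set. A \<subseteq> (\<Union>i. U i) \<and> (\<forall>i. bounded (U i) \<and> diameter (U i) \<le> \<delta>)}.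
        \<Sum>i. diam_powr s (U i))"

(* Hausdorff outer measure on arbitrary sets, meant for s \<ge> 0. *)
definition hausdorff_measure :: "real \<Rightarrow> 'a::metric_space set \<Rightarrow> ennreal" where
  "hausdorff_measure s A = (SUP \<delta> \<in> {0<..}. hausdorff_pre_measure s \<delta> A)"

(* Restricted to Euclidean spaces, where the infimum is over a nonempty set (it contains every
   s > DIM('a)), so that a real-valued dimension loses nothing. *)
definition hausdorff_dim :: "'a::euclidean_space set \<Rightarrow> real" where
  "hausdorff_dim A = Inf {s. 0 \<le> s \<and> hausdorff_measure s A = 0}"

(* The usual digit d_i, i \<ge> 1, is d (i - 1) here. *)
definition q_expansions :: "real \<Rightarrow> real \<Rightarrow> (nat \<Rightarrow> real) set" where
  "q_expansions q x = {d. (\<forall>i. d i \<in> {0, 1, q}) \<and> (\<lambda>i. d i / q ^ Suc i) sums x}"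

definition E_set :: "real \<Rightarrow> real set" where
  "E_set q = {x. q_expansions q x \<noteq> {}}"

definition U_continuum :: "real \<Rightarrow> real set" where
  "U_continuum q = {x \<in> E_set q. q_expansions q x \<approx> (UNIV :: nat set set)}"

end

(* Write f_a x = (x + a) / q.  The exact overlap f_0 f_q = f_1 f_0 governs everything.

   Almost all points have a continuum of expansions: a point from which no expansion leads to a
   point with a unique expansion has a perfect set of expansions, so it suffices that the set W of
   points with a unique expansion is null.

   Let golden = (3 + sqrt 5) / 2.  If q \<le> golden, then E_q is the interval [0, q / (q - 1)] of
   dimension 1, and W is porous because it misses every scaled copy of the intersection of
   f_0 (E_q) and f_1 (E_q).

   If q > golden, then E_q = f_0 (F) + f_1 (E_q) + f_q (E_q) and F = f_0 (F) + f_1 (E_q) are disjoint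
   unions, where F = f_0 (E_q) \<union> f_1 (E_q).  This gives dimension log golden / log q, with finite
   measure.  The measure is positive because rereading digit sequences in base golden is a Hoelder
   map of this exponent from E_q onto an interval.  Finally W avoids the blocks 0q and 10, and the
   corresponding growth rate of words is smaller than golden. *)

theory Submission
  imports Defs "HOL-Real_Asymp.Real_Asymp"
begin

subsection \<open>Hausdorff measure\<close>

text \<open>The overlap is an identity of maps: both compositions send x to x / q^2 + 1 / q. Pieces
  of E_q therefore coincide whenever their words differ by exchanging 0q and 10, and the similarity
  dimension of three maps is too large. The number of words of length n up to this exchange
  satisfies a(n+1) = 3 a(n) - a(n-1), with growth rate golden. The same number is the largest base
  in which the three images of [0, q / (q - 1)] still cover it, since (t - 1)^2 = t and t^2 = 3 t -
  1 are one equation. Base golden thus has dimension exactly 1 and serves as the model for the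
  Cantor case. The obstacle for the lower bound is that a point may have many digit sequences, so
  rereading them in another base is not visibly a map. It is treated as a relation between points.
  The exchange preserves values in both bases, because the top digit is always the base itself, and
  the Hoelder estimate at distance 0 then shows the relation to be single-valued. Exceptional sets
  are handled by subadditivity of the outer measure alone, so their measurability is never at
  issue.\<close>

lemma diam_powr_empty [simp]: "diam_powr s {} = 0"
  by (simp add: diam_powr_def)

lemma diam_powr_nonempty: "s > 0 \<Longrightarrow> diam_powr s U = ennreal (diameter U powr s)"
  by (simp add: diam_powr_def)

lemma hausdorff_pre_measure_le_cover:
  assumes "A \<subseteq> (\<Union>i. U i)" "\<And>i. bounded (U i)" "\<And>i. diameter (U i) \<le> \<delta>"
  shows "hausdorff_pre_measure s \<delta> A \<le> (\<Sum>i. diam_powr s (U i))"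
  unfolding hausdorff_pre_measure_def using assms by (intro INF_lower) auto

lemma hausdorff_pre_measure_attain:
  assumes "hausdorff_pre_measure s \<delta> A < c"
  obtains U where "A \<subseteq> (\<Union>i. U i)" "\<And>i. bounded (U i)" "\<And>i. diameter (U i) \<le> \<delta>"
    "(\<Sum>i. diam_powr s (U i)) < c"
  using assms unfolding hausdorff_pre_measure_def INF_less_iff by blast

text \<open>Multiplication by a positive real commutes with the infimum, so an estimate with a
  constant factor can be checked one cover at a time. The estimates for Lipschitz images, for larger
  exponents and for Hoelder maps rest on this.\<close>

lemma le_mult_hausdorff_pre_measure:
  assumes c: "c > 0" and le: "\<And>U :: nat \<Rightarrow> 'a::metric_space set. A \<subseteq> (\<Union>i. U i) \<Longrightarrow> (\<And>i. bounded (U i)) \<Longrightarrow>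
      (\<And>i. diameter (U i) \<le> \<delta>) \<Longrightarrow> b \<le> ennreal c * (\<Sum>i. diam_powr s (U i))"
  shows "b \<le> ennreal c * hausdorff_pre_measure s \<delta> A"
proof -
  have cancel: "ennreal (1 / c) * (ennreal c * x) = x" "ennreal c * (ennreal (1 / c) * x) = x" for x
    using c by (simp_all add: mult.assoc[symmetric] ennreal_mult[symmetric])
  have "ennreal (1 / c) * b \<le> hausdorff_pre_measure s \<delta> A"
    unfolding hausdorff_pre_measure_def
  proof (rule INF_greatest, clarify)
    fix U :: "nat \<Rightarrow> 'a set"
    assume "A \<subseteq> (\<Union>i. U i)" "\<forall>i. bounded (U i) \<and> diameter (U i) \<le> \<delta>"
    then have "ennreal (1 / c) * b \<le> ennreal (1 / c) * (ennreal c * (\<Sum>i. diam_powr s (U i)))"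
      by (intro mult_left_mono le) auto
    then show "ennreal (1 / c) * b \<le> (\<Sum>i. diam_powr s (U i))" by (simp only: cancel)
  qed
  then have "ennreal c * (ennreal (1 / c) * b) \<le> ennreal c * hausdorff_pre_measure s \<delta> A"
    by (rule mult_left_mono) simp
  then show ?thesis by (simp only: cancel)
qed

lemma hausdorff_pre_measure_mono:
  assumes "A \<subseteq> B" shows "hausdorff_pre_measure s \<delta> A \<le> hausdorff_pre_measure s \<delta> B"
  unfolding hausdorff_pre_measure_def using assms by (intro INF_superset_mono) auto

lemma hausdorff_pre_measure_antimono:
  assumes "\<delta> \<le> \<epsilon>" shows "hausdorff_pre_measure s \<epsilon> A \<le> hausdorff_pre_measure s \<delta> A"
  unfolding hausdorff_pre_measure_def using assms by (intro INF_superset_mono) (auto intro: order_trans)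

lemma hausdorff_pre_measure_empty [simp]:
  assumes "0 \<le> \<delta>" shows "hausdorff_pre_measure s \<delta> {} = 0"
  using hausdorff_pre_measure_le_cover[of "{}" "\<lambda>_. {}" \<delta> s] assms by simp

lemma hausdorff_pre_measure_le_diam_powr:
  assumes "bounded A" "diameter A \<le> \<delta>" "0 \<le> \<delta>"
  shows "hausdorff_pre_measure s \<delta> A \<le> diam_powr s A"
proof -
  let ?U = "\<lambda>i::nat. if i = 0 then A else {}"
  have "hausdorff_pre_measure s \<delta> A \<le> (\<Sum>i. diam_powr s (?U i))"
    using assms by (intro hausdorff_pre_measure_le_cover) auto
  also have "\<dots> = (\<Sum>i\<in>{0}. diam_powr s (?U i))"
    by (rule suminf_finite) auto
  finally show ?thesis by simp
qed

lemma hausdorff_pre_measure_countably_subadditive: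
  fixes A :: "nat \<Rightarrow> 'a::metric_space set"
  shows "hausdorff_pre_measure s \<delta> (\<Union>i. A i) \<le> (\<Sum>i. hausdorff_pre_measure s \<delta> (A i))"
proof (rule ennreal_le_epsilon)
  fix e :: real assume fin: "(\<Sum>i. hausdorff_pre_measure s \<delta> (A i)) < top" and e: "0 < e"
  have fin': "hausdorff_pre_measure s \<delta> (A n) < top" for n
    using fin by (metis ennreal_suminf_lessD)
  have "\<exists>U. A n \<subseteq> (\<Union>i. U i) \<and> (\<forall>i. bounded (U i) \<and> diameter (U i) \<le> \<delta>) \<and>
      (\<Sum>i. diam_powr s (U i)) \<le> hausdorff_pre_measure s \<delta> (A n) + ennreal (e * (1/2)^Suc n)" for n
  proof -
    have "hausdorff_pre_measure s \<delta> (A n) < hausdorff_pre_measure s \<delta> (A n) + ennreal (e * (1/2)^Suc n)"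
      using fin'[of n] e
        ennreal_add_left_cancel_less[of "hausdorff_pre_measure s \<delta> (A n)" 0 "ennreal (e * (1/2)^Suc n)"]
      by (auto simp: less_top)
    then show ?thesis
      by (elim hausdorff_pre_measure_attain) (metis order_less_imp_le)
  qed
  then obtain U where U: "\<And>n. A n \<subseteq> (\<Union>i. U n i)" "\<And>n i. bounded (U n i)" "\<And>n i. diameter (U n i) \<le> \<delta>"
      "\<And>n. (\<Sum>i. diam_powr s (U n i)) \<le> hausdorff_pre_measure s \<delta> (A n) + ennreal (e * (1/2)^Suc n)"
    by metis
  let ?V = "\<lambda>k. case prod_decode k of (n, i) \<Rightarrow> U n i"
  have "(\<Union>i. A i) \<subseteq> (\<Union>k. ?V k)"
  proof
    fix x assume "x \<in> (\<Union>i. A i)"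
    then obtain n i where "x \<in> U n i" using U(1) by blast
    then have "x \<in> ?V (prod_encode (n, i))" by simp
    then show "x \<in> (\<Union>k. ?V k)" by (rule UN_I[OF UNIV_I])
  qed
  then have "hausdorff_pre_measure s \<delta> (\<Union>i. A i) \<le> (\<Sum>k. diam_powr s (?V k))"
    using U by (intro hausdorff_pre_measure_le_cover) (auto split: prod.split)
  also have "\<dots> = (\<Sum>k. (\<lambda>p. diam_powr s (U (fst p) (snd p))) (prod_decode k))"
    by (simp add: case_prod_beta)
  also have "\<dots> = (\<Sum>n. \<Sum>i. diam_powr s (U n i))"
    by (rule suminf_ennreal_2dimen) simp
  also have "\<dots> \<le> (\<Sum>n. hausdorff_pre_measure s \<delta> (A n) + ennreal (e * (1/2)^Suc n))"
    by (intro suminf_le U(4)) auto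
  also have "\<dots> = (\<Sum>n. hausdorff_pre_measure s \<delta> (A n)) + (\<Sum>n. ennreal (e * (1/2)^Suc n))"
    by (intro suminf_add[symmetric]) auto
  also have "(\<Sum>n. ennreal (e * (1/2)^Suc n)) = ennreal e"
    using e by (intro suminf_ennreal_eq) (use sums_mult[OF power_half_series, of e] in auto)
  finally show "hausdorff_pre_measure s \<delta> (\<Union>i. A i) \<le> (\<Sum>i. hausdorff_pre_measure s \<delta> (A i)) + ennreal e" .
qed

lemma hausdorff_pre_measure_Un_le:
  assumes "0 \<le> \<delta>"
  shows "hausdorff_pre_measure s \<delta> (A \<union> B) \<le> hausdorff_pre_measure s \<delta> A + hausdorff_pre_measure s \<delta> B"
proof -
  have "hausdorff_pre_measure s \<delta> (\<Union>i. (binaryset A B) i) \<le> (\<Sum>i. hausdorff_pre_measure s \<delta> (binaryset A B i))"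
    by (rule hausdorff_pre_measure_countably_subadditive)
  also have "\<dots> = (\<Sum>i\<in>{0,1}. hausdorff_pre_measure s \<delta> (binaryset A B i))"
    using assms by (intro suminf_finite) (auto simp: binaryset_def)
  finally show ?thesis by (simp add: binaryset_def UN_binaryset_eq)
qed

lemma hausdorff_pre_measure_le_measure:
  "\<delta> > 0 \<Longrightarrow> hausdorff_pre_measure s \<delta> A \<le> hausdorff_measure s A"
  unfolding hausdorff_measure_def by (intro SUP_upper) auto

text \<open>The pre-measure grows as \<delta> decreases, so arbitrarily small scales suffice; later
  they come from geometric sequences.\<close>

lemma hausdorff_measure_leI:
  assumes "\<And>\<epsilon>. \<epsilon> > 0 \<Longrightarrow> \<exists>\<delta>\<le>\<epsilon>. hausdorff_pre_measure s \<delta> A \<le> c"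
  shows "hausdorff_measure s A \<le> c"
  unfolding hausdorff_measure_def
  using assms by (intro SUP_least) (meson greaterThan_iff hausdorff_pre_measure_antimono order_trans)

lemma hausdorff_measure_mono:
  assumes "A \<subseteq> B" shows "hausdorff_measure s A \<le> hausdorff_measure s B"
  using assms unfolding hausdorff_measure_def
  by (intro SUP_mono) (meson hausdorff_pre_measure_mono)

lemma hausdorff_measure_empty [simp]: "hausdorff_measure s {} = 0"
  by (simp add: hausdorff_measure_def)

lemma hausdorff_measure_Un_le:
  "hausdorff_measure s (A \<union> B) \<le> hausdorff_measure s A + hausdorff_measure s B"
proof (rule hausdorff_measure_leI)
  fix \<epsilon> :: real assume "\<epsilon> > 0"
  then show "\<exists>\<delta>\<le>\<epsilon>. hausdorff_pre_measure s \<delta> (A \<union> B) \<le> hausdorff_measure s A + hausdorff_measure s B"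
    by (intro exI[of _ \<epsilon>] conjI order_trans[OF hausdorff_pre_measure_Un_le] add_mono
        hausdorff_pre_measure_le_measure) auto
qed

lemma hausdorff_measure_countable_UN_null:
  assumes "countable I" "\<And>i. i \<in> I \<Longrightarrow> hausdorff_measure s (A i) = 0"
  shows "hausdorff_measure s (\<Union>i\<in>I. A i) = 0"
proof (cases "I = {}")
  case False
  then have "I = range (from_nat_into I)"
    using assms(1) by (simp add: range_from_nat_into)
  then have eq: "(\<Union>i\<in>I. A i) = (\<Union>n. A (from_nat_into I n))"
    by (metis (no_types) image_image)
  have "hausdorff_measure s (\<Union>n. A (from_nat_into I n)) \<le> 0"
  proof (rule hausdorff_measure_leI)
    fix \<epsilon> :: real assume "\<epsilon> > 0"
    then have "hausdorff_pre_measure s \<epsilon> (A (from_nat_into I n)) = 0" for n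
      using assms(2)[OF from_nat_into[OF False]] hausdorff_pre_measure_le_measure[of \<epsilon> s]
      by (metis le_zero_eq)
    then show "\<exists>\<delta>\<le>\<epsilon>. hausdorff_pre_measure s \<delta> (\<Union>n. A (from_nat_into I n)) \<le> 0"
      using hausdorff_pre_measure_countably_subadditive[of s \<epsilon> "\<lambda>n. A (from_nat_into I n)"] by force
  qed
  then show ?thesis using eq by simp
qed simp

lemma hausdorff_pre_measure_lipschitz_image:
  fixes f :: "'a::metric_space \<Rightarrow> 'b::metric_space"
  assumes s: "s > 0" and c: "c > 0" and lip: "\<And>x y. dist (f x) (f y) \<le> c * dist x y"
  shows "hausdorff_pre_measure s (c * \<delta>) (f ` A) \<le> ennreal (c powr s) * hausdorff_pre_measure s \<delta> A"
proof (rule le_mult_hausdorff_pre_measure)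
  show "c powr s > 0" using c by simp
next
  fix U :: "nat \<Rightarrow> 'a set"
  assume cover: "A \<subseteq> (\<Union>i. U i)" and bdU: "\<And>i. bounded (U i)" and diamU: "\<And>i. diameter (U i) \<le> \<delta>"
  have dist: "dist (f x) (f y) \<le> c * diameter (U i)" if "x \<in> U i" "y \<in> U i" for x y i
  proof -
    have "c * dist x y \<le> c * diameter (U i)"
      using c that by (intro mult_left_mono diameter_bounded_bound bdU) auto
    then show ?thesis using lip[of x y] by linarith
  qed
  have bd: "bounded (f ` U i)" for i
    unfolding bounded_two_points using dist by blast
  have diam: "diameter (f ` U i) \<le> c * diameter (U i)" for i
  proof (cases "U i = {}")
    case False
    then show ?thesis
      unfolding diameter_def[of "f ` U i"] using dist by (auto intro!: cSUP_least)
  qed simp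
  have "diameter (f ` U i) \<le> c * \<delta>" for i
    using diam[of i] diamU[of i] c by (meson mult_left_mono less_imp_le order_trans)
  moreover have "f ` A \<subseteq> (\<Union>i. f ` U i)" using cover by blast
  ultimately have "hausdorff_pre_measure s (c * \<delta>) (f ` A) \<le> (\<Sum>i. diam_powr s (f ` U i))"
    using bd by (intro hausdorff_pre_measure_le_cover) auto
  also have "\<dots> \<le> (\<Sum>i. ennreal (c powr s) * diam_powr s (U i))"
  proof (intro suminf_le)
    fix i
    have "diameter (f ` U i) powr s \<le> (c * diameter (U i)) powr s"
      using s diam diameter_ge_0[OF bd] by (intro powr_mono2) auto
    also have "\<dots> = c powr s * diameter (U i) powr s"
      by (rule powr_mult)
    finally show "diam_powr s (f ` U i) \<le> ennreal (c powr s) * diam_powr s (U i)"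
      using s by (simp add: diam_powr_nonempty flip: ennreal_mult)
  qed auto
  finally show "hausdorff_pre_measure s (c * \<delta>) (f ` A) \<le> ennreal (c powr s) * (\<Sum>i. diam_powr s (U i))"
    by simp
qed

lemma hausdorff_measure_lipschitz_image:
  assumes "s > 0" and c: "c > 0" and lip: "\<And>x y. dist (f x) (f y) \<le> c * dist x y"
  shows "hausdorff_measure s (f ` A) \<le> ennreal (c powr s) * hausdorff_measure s A"
proof (rule hausdorff_measure_leI)
  fix \<epsilon> :: real assume \<epsilon>: "\<epsilon> > 0"
  have "hausdorff_pre_measure s (c * (\<epsilon> / c)) (f ` A)
      \<le> ennreal (c powr s) * hausdorff_pre_measure s (\<epsilon> / c) A"
    using assms by (intro hausdorff_pre_measure_lipschitz_image) auto
  also have "\<dots> \<le> ennreal (c powr s) * hausdorff_measure s A"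
    using \<epsilon> c by (intro mult_left_mono hausdorff_pre_measure_le_measure) auto
  finally show "\<exists>\<delta>\<le>\<epsilon>. hausdorff_pre_measure s \<delta> (f ` A) \<le> ennreal (c powr s) * hausdorff_measure s A"
    using c by auto
qed

text \<open>A set of diameter d \<le> \<delta> satisfies d^t \<le> \<delta>^(t - s) d^s, and the
  factor \<delta>^(t - s) tends to 0.\<close>

lemma hausdorff_measure_eq_0_of_finite:
  fixes A :: "'a::metric_space set"
  assumes s: "0 \<le> s" "s < t" and fin: "hausdorff_measure s A < \<infinity>"
  shows "hausdorff_measure t A = 0"
proof -
  have le: "hausdorff_pre_measure t \<delta> A \<le> ennreal (\<delta> powr (t - s)) * hausdorff_measure s A"
    if \<delta>: "\<delta> > 0" for \<delta>
  proof -
    have "hausdorff_pre_measure t \<delta> A \<le> ennreal (\<delta> powr (t - s)) * hausdorff_pre_measure s \<delta> A"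
    proof (rule le_mult_hausdorff_pre_measure)
      show "\<delta> powr (t - s) > 0" using \<delta> by simp
    next
      fix U :: "nat \<Rightarrow> 'a set"
      assume U: "A \<subseteq> (\<Union>i. U i)" "\<And>i. bounded (U i)" "\<And>i. diameter (U i) \<le> \<delta>"
      have "hausdorff_pre_measure t \<delta> A \<le> (\<Sum>i. diam_powr t (U i))"
        using U by (intro hausdorff_pre_measure_le_cover) auto
      also have "\<dots> \<le> (\<Sum>i. ennreal (\<delta> powr (t - s)) * diam_powr s (U i))"
      proof (intro suminf_le)
        fix i
        have d: "0 \<le> diameter (U i)" "diameter (U i) \<le> \<delta>" using U diameter_ge_0 by auto
        have "diameter (U i) powr t = diameter (U i) powr (t - s) * diameter (U i) powr s"
          by (simp flip: powr_add)
        also have "\<dots> \<le> \<delta> powr (t - s) * diameter (U i) powr s"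
          using d s by (intro mult_right_mono powr_mono2) auto
        finally have *: "diameter (U i) powr t \<le> \<delta> powr (t - s) * diameter (U i) powr s" .
        show "diam_powr t (U i) \<le> ennreal (\<delta> powr (t - s)) * diam_powr s (U i)"
        \<comment> \<open>At s = 0 a nonempty set has weight 1, while
          \<open>diameter (U i) powr s\<close> is 0 for a single point; hence the separate
          case.\<close>
        proof (cases "s = 0")
          case True
          then show ?thesis using d s powr_mono2[of t "diameter (U i)" \<delta>]
            by (auto simp: diam_powr_def ennreal_leI)
        next
          case False
          then show ?thesis using s * by (simp add: diam_powr_nonempty flip: ennreal_mult)
        qed
      qed auto
      finally show "hausdorff_pre_measure t \<delta> A \<le> ennreal (\<delta> powr (t - s)) * (\<Sum>i. diam_powr s (U i))"
        by simp
    qed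
    also have "\<dots> \<le> ennreal (\<delta> powr (t - s)) * hausdorff_measure s A"
      using \<delta> by (intro mult_left_mono hausdorff_pre_measure_le_measure) auto
    finally show ?thesis .
  qed
  obtain h where h: "0 \<le> h" "hausdorff_measure s A = ennreal h"
    using fin by (metis ennreal_cases infinity_ennreal_def less_irrefl)
  have "hausdorff_pre_measure t \<epsilon> A \<le> ennreal (0 * h)" if "\<epsilon> > 0" for \<epsilon>
  proof (rule tendsto_lowerbound)
    show "((\<lambda>\<delta>. ennreal (\<delta> powr (t - s) * h)) \<longlongrightarrow> ennreal (0 * h)) (at_right 0)"
      using s by (intro tendsto_ennrealI tendsto_mult tendsto_const) real_asymp
    have "eventually (\<lambda>\<delta>. \<delta> \<in> {0<..<\<epsilon>}) (at_right 0)"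
      using that eventually_at_right_real by blast
    then show "eventually (\<lambda>\<delta>. hausdorff_pre_measure t \<epsilon> A \<le> ennreal (\<delta> powr (t - s) * h)) (at_right 0)"
    proof eventually_elim
      case (elim \<delta>)
      then show ?case using le[of \<delta>] h hausdorff_pre_measure_antimono[of \<delta> \<epsilon> t A]
        by (auto simp: ennreal_mult intro: order_trans)
    qed
  qed auto
  then show ?thesis by (simp add: hausdorff_measure_def)
qed

text \<open>One exponent with positive finite measure pins down the dimension: the measure vanishes
  above \<open>s\<close>, and if it vanished at some t < s, it would vanish at \<open>s\<close>
  too.\<close>

lemma hausdorff_dim_eqI:
  assumes s: "0 \<le> s" and "hausdorff_measure s A \<in> {0<..<\<infinity>}"
  shows "hausdorff_dim A = s"
proof -
  have "hausdorff_measure t A = 0 \<longleftrightarrow> s < t" if "0 \<le> t" for t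
    using hausdorff_measure_eq_0_of_finite[of s t A] hausdorff_measure_eq_0_of_finite[of t s A] assms that
    by (cases s t rule: linorder_cases) auto
  then have "{t. 0 \<le> t \<and> hausdorff_measure t A = 0} = {s<..}" using s by force
  then show ?thesis by (simp add: hausdorff_dim_def)
qed

text \<open>The image of each \<open>A \<inter> U i\<close> has oscillation at most C diam^s and so
  fits into an interval of that length. These intervals cover [a, b], and subadditivity of length
  bounds b - a. They stand in for the images, which need not be measurable.\<close>

lemma hausdorff_measure_ge_of_holder:
  fixes g :: "'a::metric_space \<Rightarrow> real"
  assumes s: "s > 0" and C: "C > 0" and onto: "{a..b} \<subseteq> g ` A"
    and holder: "\<And>x y. x \<in> A \<Longrightarrow> y \<in> A \<Longrightarrow> \<bar>g x - g y\<bar> \<le> C * dist x y powr s"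
  shows "ennreal (b - a) \<le> ennreal C * hausdorff_measure s A"
proof -
  have "ennreal (b - a) \<le> ennreal C * hausdorff_pre_measure s 1 A"
  proof (rule le_mult_hausdorff_pre_measure[OF C])
    fix U :: "nat \<Rightarrow> 'a set"
    assume U: "A \<subseteq> (\<Union>i. U i)" "\<And>i. bounded (U i)"
    define r where "r i = C * diameter (U i) powr s" for i
    have "\<exists>J. g ` (A \<inter> U i) \<subseteq> J \<and> J \<in> sets lborel \<and> emeasure lborel J \<le> ennreal (r i)" for i
    proof (cases "A \<inter> U i = {}")
      case True then show ?thesis by (intro exI[of _ "{}"]) auto
    next
      case False
      have dist: "\<bar>g x - g y\<bar> \<le> r i" if "x \<in> A \<inter> U i" "y \<in> A \<inter> U i" for x y
      proof -
        have "\<bar>g x - g y\<bar> \<le> C * dist x y powr s" using holder that by blast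
        also have "\<dots> \<le> r i" unfolding r_def
          using that C U s by (intro mult_left_mono powr_mono2 diameter_bounded_bound) auto
        finally show ?thesis .
      qed
      obtain x0 where x0: "x0 \<in> A \<inter> U i" using False by blast
      have bb: "bdd_below (g ` (A \<inter> U i))"
        using dist[OF _ x0] by (intro bdd_belowI2[of _ "g x0 - r i"]) (force simp: abs_le_iff)
      define m where "m = Inf (g ` (A \<inter> U i))"
      have "g x \<in> {m..m + r i}" if x: "x \<in> A \<inter> U i" for x
      proof -
        have "m \<le> g x" unfolding m_def using bb x by (intro cINF_lower) auto
        moreover have "g x - r i \<le> m" unfolding m_def using False dist[OF x]
          by (intro cINF_greatest) (force simp: abs_le_iff)+
        ultimately show ?thesis by auto
      qed
      moreover have "r i \<ge> 0" using C by (simp add: r_def)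
      ultimately show ?thesis by (intro exI[of _ "{m..m + r i}"]) auto
    qed
    then obtain J where J: "\<And>i. g ` (A \<inter> U i) \<subseteq> J i" "\<And>i. J i \<in> sets lborel"
      "\<And>i. emeasure lborel (J i) \<le> ennreal (r i)" by metis
    have "{a..b} \<subseteq> (\<Union>i. J i)"
    proof
      fix y assume "y \<in> {a..b}"
      then obtain x where "x \<in> A" "y = g x" using onto by auto
      moreover from this obtain i where "x \<in> U i" using U(1) by auto
      ultimately have "y \<in> J i" using J(1)[of i] by auto
      then show "y \<in> (\<Union>i. J i)" by auto
    qed
    then have "ennreal (b - a) \<le> emeasure lborel (\<Union>i. J i)"
      using emeasure_mono[of "{a..b}" "\<Union>i. J i" lborel] J(2)
      by (cases "a \<le> b") (auto simp: ennreal_neg)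
    also have "\<dots> \<le> (\<Sum>i. emeasure lborel (J i))"
      using J by (intro emeasure_subadditive_countably) auto
    also have "\<dots> \<le> (\<Sum>i. ennreal C * diam_powr s (U i))"
      using J(3) s C by (intro suminf_le) (auto simp: diam_powr_nonempty r_def ennreal_mult)
    finally show "ennreal (b - a) \<le> ennreal C * (\<Sum>i. diam_powr s (U i))" by simp
  qed
  also have "\<dots> \<le> ennreal C * hausdorff_measure s A"
    by (intro mult_left_mono hausdorff_pre_measure_le_measure) auto
  finally show ?thesis .
qed

text \<open>Halving n times gives covers of total length b - a at scale (b - a) / 2^n. The lower
  bound will come from the identity as a Hoelder map of exponent 1.\<close>

lemma hausdorff_measure_1_interval_le:
  fixes a b :: real
  assumes "a \<le> b"
  shows "hausdorff_measure 1 {a..b} \<le> ennreal (b - a)"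
proof -
  have pre: "hausdorff_pre_measure 1 ((b - a) / 2 ^ n) {a..b} \<le> ennreal (b - a)" if "a \<le> b" for a b :: real and n
    using that
  proof (induction n arbitrary: a b)
    case 0
    then show ?case
      using hausdorff_pre_measure_le_diam_powr[of "{a..b}" "b - a" 1] by (auto simp: diam_powr_nonempty)
  next
    case (Suc n)
    define m where "m = (a + b) / 2"
    have m: "a \<le> m" "m \<le> b" "(b - a) / 2 ^ Suc n = (m - a) / 2 ^ n" "(b - a) / 2 ^ Suc n = (b - m) / 2 ^ n"
      using Suc.prems by (auto simp: m_def field_simps)
    have "hausdorff_pre_measure 1 ((b - a) / 2 ^ Suc n) ({a..m} \<union> {m..b})
        \<le> hausdorff_pre_measure 1 ((b - a) / 2 ^ Suc n) {a..m} + hausdorff_pre_measure 1 ((b - a) / 2 ^ Suc n) {m..b}"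
      using Suc.prems by (intro hausdorff_pre_measure_Un_le) auto
    also have "\<dots> \<le> ennreal (m - a) + ennreal (b - m)"
      using Suc.IH[of a m] Suc.IH[of m b] m by (intro add_mono) auto
    also have "\<dots> = ennreal (b - a)" using m by (simp flip: ennreal_plus)
    finally show ?case using m by (simp add: ivl_disj_un_two_touch)
  qed
  show ?thesis
  proof (rule hausdorff_measure_leI)
    fix \<epsilon> :: real assume "\<epsilon> > 0"
    have "(\<lambda>n. (b - a) / 2 ^ n) \<longlonglongrightarrow> 0" by real_asymp
    then have "\<forall>\<^sub>F n in sequentially. (b - a) / 2 ^ n < \<epsilon>"
      using \<open>\<epsilon> > 0\<close> by (rule order_tendstoD)
    then obtain n where "(b - a) / 2 ^ n < \<epsilon>"
      by (auto simp: eventually_sequentially)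
    then show "\<exists>\<delta>\<le>\<epsilon>. hausdorff_pre_measure 1 \<delta> {a..b} \<le> ennreal (b - a)"
      using pre[OF assms, of n] by (intro exI[of _ "(b - a) / 2 ^ n"]) auto
  qed
qed

subsection \<open>Expansions\<close>

lemma q_expansions_Suc_iff:
  assumes "q > 1"
  shows "d \<in> q_expansions q x \<longleftrightarrow> d 0 \<in> {0, 1, q} \<and> (\<lambda>i. d (Suc i)) \<in> q_expansions q (q * x - d 0)"
proof -
  have "(\<lambda>i. d i / q ^ Suc i) sums x \<longleftrightarrow> (\<lambda>i. d (Suc i) / q ^ Suc (Suc i)) sums (x - d 0 / q)"
    by (subst sums_Suc_iff) simp
  also have "\<dots> \<longleftrightarrow> (\<lambda>i. q * (d (Suc i) / q ^ Suc (Suc i))) sums (q * (x - d 0 / q))"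
    using assms by (subst sums_mult_iff) auto
  also have "\<dots> \<longleftrightarrow> (\<lambda>i. d (Suc i) / q ^ Suc i) sums (q * x - d 0)"
    using assms by (simp add: right_diff_distrib)
  finally have "(\<lambda>i. d i / q ^ Suc i) sums x \<longleftrightarrow> (\<lambda>i. d (Suc i) / q ^ Suc i) sums (q * x - d 0)" .
  moreover have "(\<forall>i. d i \<in> {0, 1, q}) \<longleftrightarrow> d 0 \<in> {0, 1, q} \<and> (\<forall>i. d (Suc i) \<in> {0, 1, q})"
    by (metis not0_implies_Suc)
  ultimately show ?thesis by (simp add: q_expansions_def)
qed

lemma case_nat_in_q_expansions_iff:
  assumes "q > 1"
  shows "case_nat a d \<in> q_expansions q x \<longleftrightarrow> a \<in> {0, 1, q} \<and> d \<in> q_expansions q (q * x - a)"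
  using q_expansions_Suc_iff[OF assms, of "case_nat a d"] by simp

lemma case_nat_in_q_expansions:
  assumes "q > 1" "a \<in> {0, 1, q}" "d \<in> q_expansions q x"
  shows "case_nat a d \<in> q_expansions q ((x + a) / q)"
  using assms by (simp add: case_nat_in_q_expansions_iff)

lemma case_nat_decomp: "d = case_nat (d 0) (\<lambda>i. d (Suc i))"
  by (auto simp: fun_eq_iff split: nat.split)

lemma sums_geometric_tail:
  assumes "(q::real) > 1" shows "(\<lambda>i. q / q ^ Suc (i + n)) sums (q / (q - 1) / q ^ n)"
proof -
  have "(\<lambda>i. (1 / q) ^ i * (1 / q ^ n)) sums (1 / (1 - 1 / q) * (1 / q ^ n))"
    using assms by (intro sums_mult2 geometric_sums) auto
  moreover have "1 / (1 - 1 / q) * (1 / q ^ n) = q / (q - 1) / q ^ n"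
    using assms by (simp add: field_simps)
  moreover have "(1 / q) ^ i * (1 / q ^ n) = q / q ^ Suc (i + n)" for i
    using assms by (simp add: field_simps power_add)
  ultimately show ?thesis by simp
qed

lemma digit_bounds:
  assumes "(q::real) > 1" "a \<in> {0, 1, q}" shows "0 \<le> a" "a \<le> q"
  using assms by auto

text \<open>The upper limit is the tail with all digits equal to q. Each condition involves finitely
  many digits only, which gives closedness in the product topology and lets expansions be built
  digit by digit.\<close>

lemma in_q_expansions_iff_partial_sums:
  assumes q: "q > 1"
  shows "d \<in> q_expansions q x \<longleftrightarrow>
    (\<forall>i. d i \<in> {0, 1, q}) \<and> (\<forall>n. x - (\<Sum>i<n. d i / q ^ Suc i) \<in> {0..q / (q - 1) / q ^ n})"
proof (intro iffI conjI)
  assume d: "d \<in> q_expansions q x"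
  then show dig: "\<forall>i. d i \<in> {0, 1, q}" by (simp add: q_expansions_def)
  show "\<forall>n. x - (\<Sum>i<n. d i / q ^ Suc i) \<in> {0..q / (q - 1) / q ^ n}"
  proof
    fix n
    have tail: "(\<lambda>i. d (i + n) / q ^ Suc (i + n)) sums (x - (\<Sum>i<n. d i / q ^ Suc i))"
      using d by (intro sums_split_initial_segment) (simp add: q_expansions_def)
    have "0 \<le> d i / q ^ Suc i" "d i / q ^ Suc i \<le> q / q ^ Suc i" for i
      using q digit_bounds[OF q dig[rule_format, of i]] by (intro divide_right_mono divide_nonneg_nonneg; simp)+
    then show "x - (\<Sum>i<n. d i / q ^ Suc i) \<in> {0..q / (q - 1) / q ^ n}"
      using sums_le[OF _ sums_zero tail] sums_le[OF _ tail sums_geometric_tail[OF q]] by auto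
  qed
next
  assume R: "(\<forall>i. d i \<in> {0, 1, q}) \<and> (\<forall>n. x - (\<Sum>i<n. d i / q ^ Suc i) \<in> {0..q / (q - 1) / q ^ n})"
  have lim: "(\<lambda>n. q / (q - 1) / q ^ n) \<longlonglongrightarrow> 0" using q by real_asymp
  have "(\<lambda>n. x - (\<Sum>i<n. d i / q ^ Suc i)) \<longlonglongrightarrow> 0"
    by (rule real_tendsto_sandwich[OF _ _ tendsto_const lim]) (use R in auto)
  then have "(\<lambda>n. x - (x - (\<Sum>i<n. d i / q ^ Suc i))) \<longlonglongrightarrow> x - 0"
    by (intro tendsto_intros)
  then show "d \<in> q_expansions q x" using R by (simp add: q_expansions_def sums_def)
qed

lemma q_expansions_nonempty_bounds:
  assumes "q > 1" "d \<in> q_expansions q x" shows "0 \<le> x" "x \<le> q / (q - 1)"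
  using assms(2) unfolding in_q_expansions_iff_partial_sums[OF assms(1)] by (auto dest: spec[of _ 0])

lemma E_set_subset: "q > 1 \<Longrightarrow> E_set q \<subseteq> {0..q / (q - 1)}"
  using q_expansions_nonempty_bounds by (fastforce simp: E_set_def)

lemma q_expansions_exI:
  assumes "q > 1" "\<And>i. d i \<in> {0, 1, q}"
  obtains x where "d \<in> q_expansions q x"
proof -
  have "summable (\<lambda>i. d i / q ^ Suc i)"
  proof (rule summable_comparison_test')
    show "summable (\<lambda>i. q / q ^ Suc i)"
      using sums_geometric_tail[OF assms(1), of 0] by (simp add: sums_iff)
    show "norm (d i / q ^ Suc i) \<le> q / q ^ Suc i" for i
      using assms digit_bounds[OF assms(1) assms(2)[of i]]
      by (simp only: real_norm_def abs_of_nonneg divide_nonneg_nonneg zero_le_power less_imp_le)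
        (intro divide_right_mono; simp)
  qed
  then show ?thesis using that assms(2) by (auto simp: q_expansions_def)
qed

text \<open>The block \<open>0q\<close> may be replaced by \<open>10\<close>: both contribute \<open>q\<close> at scale \<open>q\<^sup>-\<^sup>2\<close>.\<close>

lemma q_expansions_exchange:
  assumes "q > 1"
  shows "case_nat 0 (case_nat q d) \<in> q_expansions q x \<longleftrightarrow> case_nat 1 (case_nat 0 d) \<in> q_expansions q x"
  using assms by (simp add: case_nat_in_q_expansions_iff algebra_simps)

lemma closed_q_expansions:
  assumes "q > 1" shows "closed (q_expansions q x)"
proof -
  have cont: "continuous_on UNIV (\<lambda>d::nat \<Rightarrow> real. d i)" for i
    by (rule continuous_on_product_coordinates)
  have "closed {d::nat \<Rightarrow> real. d i \<in> {0, 1, q}}" for i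
    using closed_vimage[OF _ cont, of "{0, 1, q}" i] by (simp add: vimage_def)
  moreover have "closed {d. x - (\<Sum>i<n. d i / q ^ Suc i) \<in> {0..q / (q - 1) / q ^ n}}" for n
    unfolding atLeastAtMost_iff
    by (intro closed_Collect_conj closed_Collect_le continuous_intros cont) (use assms in auto)
  ultimately have "closed {d. (\<forall>i. d i \<in> {0, 1, q}) \<and> (\<forall>n. x - (\<Sum>i<n. d i / q ^ Suc i) \<in> {0..q / (q - 1) / q ^ n})}"
    by (intro closed_Collect_conj closed_Collect_all)
  then show ?thesis
    by (simp only: in_q_expansions_iff_partial_sums[OF assms, symmetric] Collect_mem_eq)
qed

text \<open>A digit sequence is determined by its positions of 0 and of 1, two sets of naturals that
  \<open>sum_encode\<close> packs into one.\<close>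

lemma q_expansions_lepoll:
  "q_expansions q x \<lesssim> (UNIV :: nat set set)"
proof -
  have "inj_on (\<lambda>d. {i. d i = 0} <+> {i. d i = 1}) (q_expansions q x)"
  proof (rule inj_onI)
    fix d e assume "d \<in> q_expansions q x" "e \<in> q_expansions q x"
      and eq: "{i. d i = 0} <+> {i. d i = 1} = {i. e i = 0} <+> {i. e i = 1}"
    then have "d i \<in> {0, 1, q}" "e i \<in> {0, 1, q}" for i by (auto simp: q_expansions_def)
    moreover have "d i = 0 \<longleftrightarrow> e i = 0" "d i = 1 \<longleftrightarrow> e i = 1" for i
    proof -
      have "Inl i \<in> {i. d i = 0} <+> {i. d i = 1} \<longleftrightarrow> Inl i \<in> {i. e i = 0} <+> {i. e i = 1}"
        "Inr i \<in> {i. d i = 0} <+> {i. d i = 1} \<longleftrightarrow> Inr i \<in> {i. e i = 0} <+> {i. e i = 1}"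
        using eq by simp_all
      then show "d i = 0 \<longleftrightarrow> e i = 0" "d i = 1 \<longleftrightarrow> e i = 1" by auto
    qed
    ultimately show "d = e" by (metis (no_types, opaque_lifting) empty_iff ext insert_iff)
  qed
  moreover have "inj_on ((`) sum_encode) (UNIV :: (nat + nat) set set)"
    by (intro inj_onI) (simp add: inj_image_eq_iff[OF inj_sum_encode])
  ultimately have "inj_on (\<lambda>d. sum_encode ` ({i. d i = 0} <+> {i. d i = 1})) (q_expansions q x)"
    by (metis (mono_tags, lifting) UNIV_I inj_on_def)
  then show ?thesis unfolding lepoll_def by blast
qed

text \<open>\<open>foldr case_nat w e\<close> is the word w followed by the sequence e. The other
  fold is the composition of the maps f_a along w, the first letter outermost.\<close>

lemma q_expansions_append:
  assumes "q > 1" "set w \<subseteq> {0, 1, q}" "e \<in> q_expansions q y"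
  shows "foldr case_nat w e \<in> q_expansions q (foldr (\<lambda>a x. (x + a) / q) w y)"
  using assms(2) by (induction w) (use assms(1,3) in \<open>auto intro!: case_nat_in_q_expansions\<close>)

lemma foldr_case_nat_inject: "foldr case_nat w d = foldr case_nat w e \<longleftrightarrow> d = e"
proof (induction w)
  case (Cons a w)
  have "(case_nat a d' :: nat \<Rightarrow> 'a) = case_nat a e' \<longleftrightarrow> d' = e'" for d' e'
    by (metis ext old.nat.simps(5))
  then show ?case using Cons.IH by simp
qed simp

lemma foldr_case_nat_prefix: "i < length w \<Longrightarrow> foldr case_nat w d i = w ! i"
  by (induction w arbitrary: i) (auto split: nat.split)

lemma q_expansions_split:
  assumes "q > 1" "d \<in> q_expansions q x"
  shows "\<exists>w y e. set w \<subseteq> {0, 1, q} \<and> length w = n \<and> e \<in> q_expansions q y \<and>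
    d = foldr case_nat w e \<and> x = foldr (\<lambda>a x. (x + a) / q) w y"
  using assms(2)
proof (induction n arbitrary: d x)
  case 0
  then show ?case by (intro exI[of _ "[]"]) auto
next
  case (Suc n)
  then have d0: "d 0 \<in> {0, 1, q}" and "(\<lambda>i. d (Suc i)) \<in> q_expansions q (q * x - d 0)"
    using q_expansions_Suc_iff[OF assms(1)] by blast+
  from Suc.IH[OF this(2)] obtain w y e where
    "set w \<subseteq> {0, 1, q}" "length w = n" "e \<in> q_expansions q y" "(\<lambda>i. d (Suc i)) = foldr case_nat w e"
    "q * x - d 0 = foldr (\<lambda>a x. (x + a) / q) w y" by blast
  then show ?case
    using d0 assms(1) case_nat_decomp[of d]
    by (intro exI[of _ "d 0 # w"] exI[of _ y] exI[of _ e]) (auto simp flip: \<open>q * x - d 0 = _\<close>)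
qed

section \<open>Unique expansions as the only obstruction to a continuum of expansions\<close>

definition unique_set :: "real \<Rightarrow> real set" where
  "unique_set q = {x. is_singleton (q_expansions q x)}"

lemma unique_set_subset: "unique_set q \<subseteq> E_set q"
  by (auto simp: unique_set_def E_set_def is_singleton_def)

text \<open>If no point reached from \<open>x\<close> along an expansion has a unique expansion, then the closed set of
  expansions of \<open>x\<close> has no isolated points, hence is perfect.\<close>

lemma E_set_minus_U_continuum_subset:
  assumes q: "q > 1"
  shows "E_set q - U_continuum q \<subseteq> (\<Union>w\<in>lists {0, 1, q}. foldr (\<lambda>a x. (x + a) / q) w ` unique_set q)"
proof (rule ccontr)
  assume "\<not> ?thesis"
  then obtain x where x: "x \<in> E_set q" "x \<notin> U_continuum q"
    and nx: "\<And>w. set w \<subseteq> {0, 1, q} \<Longrightarrow> x \<notin> foldr (\<lambda>a x. (x + a) / q) w ` unique_set q"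
    by (auto simp: in_lists_conv_set subset_iff)
  let ?X = "q_expansions q x"
  have limpt: "d islimpt ?X" if d: "d \<in> ?X" for d
  proof -
    have "\<exists>d'. d' \<in> ?X - {d} \<and> (\<forall>i<n. d' i = d i)" for n
    proof -
      obtain w y e where w: "set w \<subseteq> {0, 1, q}" "length w = n" "e \<in> q_expansions q y"
        "d = foldr case_nat w e" "x = foldr (\<lambda>a x. (x + a) / q) w y"
        using q_expansions_split[OF q d] by blast
      then have "y \<notin> unique_set q" using nx[OF w(1)] by blast
      \<comment> \<open>A second expansion of the point left after n digits yields an expansion of x
        that differs from d but has the same first n digits.\<close>
      then obtain e' where e': "e' \<in> q_expansions q y" "e' \<noteq> e"
        using w(3) unfolding unique_set_def is_singleton_def by blast
      then have "foldr case_nat w e' \<in> ?X - {d}"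
        using q_expansions_append[OF q w(1) e'(1)] by (simp add: w(4,5) foldr_case_nat_inject)
      then show ?thesis using w by (intro exI[of _ "foldr case_nat w e'"]) (simp add: foldr_case_nat_prefix)
    qed
    then obtain D where D: "\<And>n. D n \<in> ?X - {d}" "\<And>n i. i < n \<Longrightarrow> D n i = d i" by metis
    have "(\<lambda>n. D n i) \<longlonglongrightarrow> d i" for i
      by (rule tendsto_eventually) (use D(2) in \<open>auto intro: eventually_mono[OF eventually_gt_at_top[of i]]\<close>)
    then have "limitin (product_topology (\<lambda>_. euclidean) UNIV) D d sequentially"
      by (auto simp: limitin_componentwise)
    then have "D \<longlonglongrightarrow> d" by (simp add: euclidean_product_topology)
    then show ?thesis using D(1) islimpt_sequential by blast
  qed
  \<comment> \<open>A nonempty perfect set in a completely metrizable space has at least the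
    cardinality of the continuum. Being closed and having no isolated point amounts to equality with
    the derived set.\<close>
  have "(UNIV :: real set) \<lesssim> ?X"
  proof (rule lepoll_perfect_set)
    show "completely_metrizable_space (euclidean :: (nat \<Rightarrow> real) topology) \<or>
      locally_compact_space (euclidean :: (nat \<Rightarrow> real) topology) \<and> Hausdorff_space (euclidean :: (nat \<Rightarrow> real) topology)"
      by (simp add: completely_metrizable_space_euclidean)
    show "euclidean derived_set_of ?X = ?X"
    proof
      show "euclidean derived_set_of ?X \<subseteq> ?X"
        using closed_q_expansions[OF q, of x] by (metis closed_closedin closedin_contains_derived_set)
      show "?X \<subseteq> euclidean derived_set_of ?X"
        using limpt unfolding derived_set_of_def islimpt_def by fastforce
    qed
    show "?X \<noteq> {}" using x by (simp add: E_set_def)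
  qed
  then have "?X \<approx> (UNIV :: nat set set)"
    by (meson eqpoll_imp_lepoll lepoll_antisym lepoll_trans nat_sets_eqpoll_reals q_expansions_lepoll)
  then show False using x by (simp add: U_continuum_def)
qed

lemma hausdorff_measure_qmap:
  assumes "q > 1" "s > 0"
  shows "hausdorff_measure s ((\<lambda>x. (x + a) / q) ` A) \<le> ennreal (q powr (-s)) * hausdorff_measure s A"
proof -
  have "hausdorff_measure s ((\<lambda>x. (x + a) / q) ` A) \<le> ennreal ((1 / q) powr s) * hausdorff_measure s A"
    using assms
    by (intro hausdorff_measure_lipschitz_image)
      (auto simp: dist_real_def abs_le_iff simp flip: diff_divide_distrib)
  also have "(1 / q) powr s = q powr (-s)" using assms by (simp add: powr_divide powr_minus_divide)
  finally show ?thesis .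
qed

text \<open>There are countably many words and every map f_w is Lipschitz, so all the exceptional
  points together inherit measure 0 from \<open>unique_set q\<close>.\<close>

lemma hausdorff_measure_U_continuum_eq:
  assumes q: "q > 1" "s > 0" and null: "hausdorff_measure s (unique_set q) = 0"
  shows "hausdorff_measure s (U_continuum q) = hausdorff_measure s (E_set q)"
proof -
  have "hausdorff_measure s (foldr (\<lambda>a x. (x + a) / q) w ` unique_set q) = 0" for w
  proof (induction w)
    case (Cons a w)
    have "hausdorff_measure s ((\<lambda>x. (x + a) / q) ` (foldr (\<lambda>a x. (x + a) / q) w ` unique_set q)) \<le> 0"
      using hausdorff_measure_qmap[OF q, of a "foldr (\<lambda>a x. (x + a) / q) w ` unique_set q"] Cons.IH by simp
    then show ?case by (simp add: image_image o_def)
  qed (simp add: null)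
  then have "hausdorff_measure s (\<Union>w\<in>lists {0, 1, q}. foldr (\<lambda>a x. (x + a) / q) w ` unique_set q) = 0"
    by (intro hausdorff_measure_countable_UN_null) (auto intro: countable_lists)
  then have "hausdorff_measure s (E_set q - U_continuum q) = 0"
    using hausdorff_measure_mono[OF E_set_minus_U_continuum_subset[OF q(1)], of s] by simp
  then have "hausdorff_measure s (E_set q) \<le> hausdorff_measure s (U_continuum q)"
    using hausdorff_measure_Un_le[of s "E_set q - U_continuum q" "U_continuum q"]
      hausdorff_measure_mono[of "E_set q" "E_set q - U_continuum q \<union> U_continuum q" s]
    by (metis Un_Diff_cancel2 Un_upper1 add.left_neutral order_trans)
  moreover have "U_continuum q \<subseteq> E_set q" by (auto simp: U_continuum_def)
  ultimately show ?thesis by (simp add: hausdorff_measure_mono order.antisym)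
qed

subsection \<open>The interval case\<close>

text \<open>With M = q / (q - 1) the hypothesis reads q \<le> M + 1: the image of [0, M] under f_1
  reaches the left end 1 of its image under f_q. Every point of [0, M] thus has a digit whose
  removal stays in [0, M].\<close>

lemma E_set_eq_interval:
  assumes q: "q > 1" and le: "(q - 1)\<^sup>2 \<le> q"
  shows "E_set q = {0..q / (q - 1)}"
proof (intro equalityI E_set_subset q subsetI)
  fix x assume x: "x \<in> {0..q / (q - 1)}"
  define M where "M = q / (q - 1)"
  have M: "q * M - q = M" "M \<ge> 1" "q \<le> M + 1"
    using q le by (auto simp: M_def field_simps power2_eq_square)
  have "\<exists>a\<in>{0, 1, q}. q * z - a \<in> {0..M}" if z: "z \<in> {0..M}" for z
  proof -
    have "0 \<le> q * z" "q * z \<le> q * M" using z q by auto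
    then have "q * z - 0 \<in> {0..M} \<or> q * z - 1 \<in> {0..M} \<or> q * z - q \<in> {0..M}"
      unfolding atLeastAtMost_iff using M by linarith
    then show ?thesis by blast
  qed
  then obtain a where a: "\<And>z. z \<in> {0..M} \<Longrightarrow> a z \<in> {0, 1, q} \<and> q * z - a z \<in> {0..M}" by metis
  \<comment> \<open>\<open>t n\<close> is q^n times the remainder after n digits, so staying in
    [0, M] is exactly the condition on partial sums.\<close>
  define t where "t n = ((\<lambda>z. q * z - a z) ^^ n) x" for n
  have t: "t n \<in> {0..M}" for n
    by (induction n) (use a x in \<open>auto simp: t_def M_def\<close>)
  have eq: "x - (\<Sum>i<n. a (t i) / q ^ Suc i) = t n / q ^ n" for n
    by (induction n) (use q in \<open>auto simp: t_def field_simps\<close>)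
  have "t n / q ^ n \<in> {0..M / q ^ n}" for n
    unfolding atLeastAtMost_iff
    by (intro conjI divide_nonneg_nonneg divide_right_mono) (use t[of n] q in auto)
  then have "(\<lambda>i. a (t i)) \<in> q_expansions q x"
    unfolding in_q_expansions_iff_partial_sums[OF q] eq using a t by (simp add: M_def)
  then show "x \<in> E_set q" by (auto simp: E_set_def)
qed

lemma foldr_notin_unique_set:
  assumes "q > 1" "set w \<subseteq> {0, 1, q}" "y \<in> E_set q" "y \<notin> unique_set q"
  shows "foldr (\<lambda>a x. (x + a) / q) w y \<notin> unique_set q"
proof -
  obtain e e' where e: "e \<in> q_expansions q y" "e' \<in> q_expansions q y" "e \<noteq> e'"
    using assms(3,4) unfolding E_set_def unique_set_def is_singleton_def by blast
  show ?thesis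
    using q_expansions_append[OF assms(1,2) e(1)] q_expansions_append[OF assms(1,2) e(2)] e(3)
    by (auto simp: unique_set_def is_singleton_def foldr_case_nat_inject[of w e e', symmetric])
qed

lemma foldr_affine:
  "foldr (\<lambda>a x. (x + a) / q) w y = foldr (\<lambda>a x. (x + a) / q) w 0 + y / q ^ length w" for q :: real
  by (induction w) (auto simp: add_divide_distrib algebra_simps)

text \<open>The interval is the intersection of f_0 (E_q) and f_1 (E_q), since M / q = 1 / (q - 1);
  its points have an expansion starting with 0 and one starting with 1.\<close>

lemma overlap_notin_unique_set:
  assumes q: "q > 1" and le: "(q - 1)\<^sup>2 \<le> q" and y: "y \<in> {1 / q..1 / (q - 1)}"
  shows "y \<in> E_set q - unique_set q"
proof -
  have "1 \<le> q * y" using y q by (simp add: field_simps)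
  moreover have "q * y \<le> q * (1 / (q - 1))" using y q by (intro mult_left_mono) auto
  ultimately have "q * y \<in> E_set q" "q * y - 1 \<in> E_set q"
    by (simp_all add: E_set_eq_interval[OF q le])
  then obtain e e' where "e \<in> q_expansions q (q * y)" "e' \<in> q_expansions q (q * y - 1)"
    by (auto simp: E_set_def)
  then have "case_nat 0 e \<in> q_expansions q y" "case_nat 1 e' \<in> q_expansions q y"
    using q by (auto simp: case_nat_in_q_expansions_iff)
  moreover have "case_nat 0 e \<noteq> case_nat 1 e'" by (metis old.nat.simps(4) zero_neq_one)
  ultimately show ?thesis by (auto simp: E_set_def unique_set_def is_singleton_def)
qed

text \<open>The gap is a copy of the overlap, scaled by a prefix of an expansion of the midpoint of
  [a, b]. For the least n with M / q^n \<le> h = (b - a) / 2, the image of [0, M] under the prefix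
  contains the midpoint, hence lies in [a, b], and is longer than h / q.\<close>

lemma unique_set_gap:
  assumes q: "q > 1" and le: "(q - 1)\<^sup>2 \<le> q" and ab: "0 \<le> a" "a < b" "b \<le> q / (q - 1)"
  obtains u v where "a \<le> u" "u \<le> v" "v \<le> b" "v - u \<ge> (b - a) / (2 * q ^ 3)" "unique_set q \<inter> {u..v} = {}"
proof -
  define M where "M = q / (q - 1)"
  define h where "h = (b - a) / 2"
  have E: "E_set q = {0..M}" by (simp add: E_set_eq_interval[OF q le] M_def)
  have h: "0 < h" "h < M" using ab by (simp_all add: h_def flip: M_def)
  have "(\<lambda>n. M / q ^ n) \<longlonglongrightarrow> 0" using q by real_asymp
  then have "\<forall>\<^sub>F n in sequentially. M / q ^ n < h" using h by (intro order_tendstoD)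
  then have ex: "\<exists>n. M / q ^ n \<le> h" by (auto simp: eventually_sequentially intro: less_imp_le)
  define n where "n = (LEAST n. M / q ^ n \<le> h)"
  have n: "M / q ^ n \<le> h" unfolding n_def by (rule LeastI_ex[OF ex])
  \<comment> \<open>Since h < M, n is not 0, so minimality applies to its predecessor.\<close>
  obtain k where k: "n = Suc k" using n h by (cases n) auto
  have "\<not> M / q ^ k \<le> h" using not_less_Least[of k "\<lambda>n. M / q ^ n \<le> h"] k by (auto simp: n_def)
  then have hk: "h < q * (M / q ^ n)" using k q by (simp add: field_simps)
  have "(a + b) / 2 \<in> E_set q" using ab by (simp add: E flip: M_def)
  then obtain d where "d \<in> q_expansions q ((a + b) / 2)" by (auto simp: E_set_def)
  from q_expansions_split[OF q this, of n] obtain w y e where w: "set w \<subseteq> {0, 1, q}" "length w = n"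
    "e \<in> q_expansions q y" "(a + b) / 2 = foldr (\<lambda>a x. (x + a) / q) w y" by blast
  define P where "P = foldr (\<lambda>a x. (x + a) / q) w 0"
  have P: "(a + b) / 2 = P + y / q ^ n" using w foldr_affine[of q w y] by (simp add: P_def)
  have "0 \<le> y" "y \<le> M" using w(3) E by (auto simp: E_set_def)
  then have y: "0 \<le> y / q ^ n" "y / q ^ n \<le> M / q ^ n"
    using q by (simp_all add: divide_right_mono)
  define u where "u = P + 1 / q / q ^ n"
  define v where "v = P + 1 / (q - 1) / q ^ n"
  have "1 / (q - 1) \<le> M" "1 / q \<le> 1 / (q - 1)" "0 \<le> 1 / q" using q by (auto simp: M_def field_simps)
  then have "0 \<le> 1 / q / q ^ n" "1 / q / q ^ n \<le> 1 / (q - 1) / q ^ n" "1 / (q - 1) / q ^ n \<le> M / q ^ n"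
    using q by (intro divide_right_mono divide_nonneg_nonneg; simp)+
  then have uv: "P \<le> u" "u \<le> v" "v \<le> P + M / q ^ n"
    by (simp_all add: u_def v_def)
  \<comment> \<open>The overlap is the fraction 1 / q^2 of [0, M]; the third factor q is the loss
    from the minimality of n.\<close>
  have "v - u = q * (M / q ^ n) / q ^ 3"
    using q by (simp add: u_def v_def M_def field_simps power3_eq_cube)
  then have gap: "v - u \<ge> h / q ^ 3" using divide_right_mono[OF less_imp_le[OF hk], of "q ^ 3"] q by simp
  have "z \<notin> unique_set q" if z: "z \<in> {u..v}" for z
  proof -
    have "(z - P) * q ^ n \<in> {1 / q..1 / (q - 1)}"
      using z q unfolding u_def v_def by (auto simp: field_simps)
    from overlap_notin_unique_set[OF q le this]
    have "foldr (\<lambda>a x. (x + a) / q) w ((z - P) * q ^ n) \<notin> unique_set q"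
      using foldr_notin_unique_set[OF q w(1)] by blast
    then show ?thesis using foldr_affine[of q w "(z - P) * q ^ n"] w(2) q by (simp add: P_def)
  qed
  then have "unique_set q \<inter> {u..v} = {}" by blast
  moreover have "a \<le> u \<and> v \<le> b"
  proof -
    have "a \<le> u \<and> v \<le> b"
      if "(a + b) / 2 = P + s" "0 \<le> s" "s \<le> t" "v \<le> P + t" "t \<le> (b - a) / 2" for s t
      using that uv(1) by (simp add: field_simps)
    then show ?thesis using P y uv(3) n unfolding h_def by blast
  qed
  ultimately show ?thesis using that[of u v] uv(2) gap by (simp add: h_def)
qed

text \<open>Removing a gap costs every interval the same fraction \<delta> of its length. The bound
  is linear in the length, so the estimates for the two remaining intervals add up, and n rounds
  give the factor (1 - \<delta>)^n.\<close>

lemma hausdorff_measure_1_unique_set: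
  assumes q: "q > 1" and le: "(q - 1)\<^sup>2 \<le> q"
  shows "hausdorff_measure 1 (unique_set q) = 0"
proof -
  define M where "M = q / (q - 1)"
  define \<delta> where "\<delta> = 1 / (2 * q ^ 3)"
  have "1 < q ^ 3" using q by (rule one_less_power) simp
  then have "1 < 2 * q ^ 3" by linarith
  then have \<delta>: "0 < \<delta>" "\<delta> < 1" using q by (simp_all add: \<delta>_def divide_less_eq_1_pos)
  have shrink: "hausdorff_measure 1 (unique_set q \<inter> {a..b}) \<le> ennreal ((1 - \<delta>) ^ n * (b - a))"
    if "0 \<le> a" "a \<le> b" "b \<le> M" for a b n
    using that
  proof (induction n arbitrary: a b)
    case 0
    then show ?case
      using hausdorff_measure_mono[of "unique_set q \<inter> {a..b}" "{a..b}" 1] hausdorff_measure_1_interval_le[of a b]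
      by (auto intro: order_trans)
  next
    case (Suc n)
    show ?case
    proof (cases "a = b")
      case True
      then show ?thesis
        using hausdorff_measure_mono[of "unique_set q \<inter> {a..b}" "{a..b}" 1] hausdorff_measure_1_interval_le[of a b]
        by auto
    next
      case False
      then obtain u v where uv: "a \<le> u" "u \<le> v" "v \<le> b" "v - u \<ge> (b - a) / (2 * q ^ 3)"
        "unique_set q \<inter> {u..v} = {}"
        using unique_set_gap[OF q le, of a b] Suc.prems by (auto simp: M_def)
      have "unique_set q \<inter> {a..b} \<subseteq> unique_set q \<inter> {a..u} \<union> unique_set q \<inter> {v..b}"
        using uv by force
      then have "hausdorff_measure 1 (unique_set q \<inter> {a..b})
          \<le> hausdorff_measure 1 (unique_set q \<inter> {a..u}) + hausdorff_measure 1 (unique_set q \<inter> {v..b})"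
        by (meson hausdorff_measure_Un_le hausdorff_measure_mono order_trans)
      also have "\<dots> \<le> ennreal ((1 - \<delta>) ^ n * (u - a)) + ennreal ((1 - \<delta>) ^ n * (b - v))"
        using Suc.prems uv by (intro add_mono Suc.IH) auto
      also have "\<dots> = ennreal ((1 - \<delta>) ^ n * (u - a) + (1 - \<delta>) ^ n * (b - v))"
        using \<delta> uv by (intro ennreal_plus[symmetric]) auto
      also have "(1 - \<delta>) ^ n * (u - a) + (1 - \<delta>) ^ n * (b - v) = (1 - \<delta>) ^ n * ((b - a) - (v - u))"
        by (simp add: algebra_simps)
      also have "ennreal \<dots> \<le> ennreal ((1 - \<delta>) ^ n * ((b - a) - \<delta> * (b - a)))"
        using \<delta> uv(4) by (intro ennreal_leI mult_left_mono) (auto simp: \<delta>_def)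
      also have "(1 - \<delta>) ^ n * ((b - a) - \<delta> * (b - a)) = (1 - \<delta>) ^ Suc n * (b - a)"
        by (simp add: algebra_simps)
      finally show ?thesis .
    qed
  qed
  have M0: "M \<ge> 0" using q by (simp add: M_def)
  have "hausdorff_measure 1 (unique_set q) \<le> ennreal ((1 - \<delta>) ^ n * M)" for n
  proof -
    have "unique_set q \<inter> {0..M} = unique_set q"
      using unique_set_subset[of q] E_set_subset[OF q] by (auto simp: M_def)
    then show ?thesis using shrink[of 0 M n] M0 by simp
  qed
  moreover have "(\<lambda>n. ennreal ((1 - \<delta>) ^ n * M)) \<longlonglongrightarrow> ennreal (0 * M)"
    using \<delta> by (intro tendsto_ennrealI tendsto_mult tendsto_const LIMSEQ_power_zero) auto
  ultimately have "hausdorff_measure 1 (unique_set q) \<le> ennreal (0 * M)"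
    by (intro LIMSEQ_le_const[of "\<lambda>n. ennreal ((1 - \<delta>) ^ n * M)"]) auto
  then show ?thesis by simp
qed

lemma hausdorff_measure_1_E_set:
  assumes q: "q > 1" and le: "(q - 1)\<^sup>2 \<le> q"
  shows "hausdorff_measure 1 (E_set q) \<in> {0<..<\<infinity>}"
proof -
  have pos: "q / (q - 1) > 0" using q by simp
  have "ennreal (q / (q - 1) - 0) \<le> ennreal 1 * hausdorff_measure 1 {0..q / (q - 1)}"
    by (rule hausdorff_measure_ge_of_holder[where g = "\<lambda>x. x"]) (auto simp: dist_real_def)
  then have "hausdorff_measure 1 {0..q / (q - 1)} > 0"
    using pos by (auto simp: ennreal_eq_0_iff zero_less_iff_neq_zero)
  moreover have "hausdorff_measure 1 {0..q / (q - 1)} < \<infinity>"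
    using hausdorff_measure_1_interval_le[of 0 "q / (q - 1)"] pos
    by (auto intro: le_less_trans)
  ultimately show ?thesis by (simp add: E_set_eq_interval[OF q le])
qed

subsection \<open>The Cantor case\<close>

definition golden :: real where
  "golden = (3 + sqrt 5) / 2"

lemma golden_square: "golden\<^sup>2 = 3 * golden - 1"
  by (simp add: golden_def power2_eq_square field_simps)

text \<open>5 / 2 separates \<open>golden\<close> from the growth rate of words without the blocks
  0q and 10, which is about 2.32.\<close>

lemma golden_gt: "5 / 2 < golden"
proof -
  have "2 < sqrt 5" by (rule real_less_rsqrt) simp
  then show ?thesis by (simp add: golden_def)
qed

text \<open>The other root of (t - 1)^2 = t is 3 - golden, which lies below 1.\<close>

lemma above_golden_iff:
  assumes "q > 1" shows "golden < q \<longleftrightarrow> q < (q - 1)\<^sup>2"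
proof -
  have "(q - 1)\<^sup>2 - q = (q - golden) * (q + golden - 3)"
    using golden_square by (simp add: power2_eq_square algebra_simps)
  then have "q < (q - 1)\<^sup>2 \<longleftrightarrow> 0 < (q - golden) * (q + golden - 3)" by linarith
  also have "\<dots> \<longleftrightarrow> golden < q" using golden_gt assms by (simp add: zero_less_mult_iff)
  finally show ?thesis by simp
qed

lemma in_E_set_iff:
  assumes "q > 1"
  shows "x \<in> E_set q \<longleftrightarrow> (\<exists>a\<in>{0, 1, q}. q * x - a \<in> E_set q)"
  using q_expansions_Suc_iff[OF assms, of _ x] case_nat_in_q_expansions_iff[OF assms, of _ _ x]
  unfolding E_set_def by blast

definition E_front :: "real \<Rightarrow> real set" where
  "E_front q = (\<Union>a\<in>{0, 1}. (\<lambda>x. (x + a) / q) ` E_set q)"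

lemma E_front_subset: "q > 1 \<Longrightarrow> E_front q \<subseteq> E_set q"
  by (auto simp: E_front_def in_E_set_iff[of q "_ / q"])

lemma image_qmapI: "q > 1 \<Longrightarrow> q * x - a \<in> A \<Longrightarrow> x \<in> (\<lambda>x. (x + a) / q) ` A" for q :: real
  by (rule image_eqI[of _ _ "q * x - a"]) auto

text \<open>A point of \<open>f\<^sub>0 (E)\<close> outside \<open>f\<^sub>0 (E_front)\<close> lies in \<open>f\<^sub>0 f\<^sub>q (E) = f\<^sub>1 f\<^sub>0 (E)\<close>.\<close>

lemma qmap_0_E_set_subset:
  assumes q: "q > 1"
  shows "(\<lambda>x. (x + 0) / q) ` E_set q \<subseteq> (\<lambda>x. (x + 0) / q) ` E_front q \<union> (\<lambda>x. (x + 1) / q) ` E_set q"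
proof clarsimp
  fix x assume x: "x \<in> E_set q" "x / q \<notin> (\<lambda>x. (x + 1) / q) ` E_set q"
  then obtain a where a: "a \<in> {0, 1, q}" "q * x - a \<in> E_set q" using in_E_set_iff[OF q] by blast
  show "x / q \<in> (\<lambda>x. x / q) ` E_front q"
  proof (cases "a = q")
    case True
    then have "x - 1 \<in> E_set q" using a q by (subst in_E_set_iff) (auto simp: algebra_simps)
    then have "x / q \<in> (\<lambda>x. (x + 1) / q) ` E_set q" using q by (intro image_qmapI) auto
    then show ?thesis using x by blast
  next
    case False
    then have "a \<in> {0, 1}" using a by blast
    moreover have "x \<in> (\<lambda>x. (x + a) / q) ` E_set q" using a(2) by (rule image_qmapI[OF q])
    ultimately have "x \<in> E_front q" unfolding E_front_def by (rule UN_I)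
    then show ?thesis by blast
  qed
qed

lemma E_set_subset_pieces:
  assumes q: "q > 1"
  shows "E_set q \<subseteq> (\<lambda>x. (x + 1) / q) ` E_set q \<union> ((\<lambda>x. (x + q) / q) ` E_set q \<union> (\<lambda>x. (x + 0) / q) ` E_front q)"
proof
  fix x assume "x \<in> E_set q"
  then obtain a where a: "a \<in> {0, 1, q}" "q * x - a \<in> E_set q" using in_E_set_iff[OF q] by blast
  have "x \<in> (\<lambda>x. (x + a) / q) ` E_set q" using a q by (intro image_qmapI) auto
  then show "x \<in> (\<lambda>x. (x + 1) / q) ` E_set q \<union> ((\<lambda>x. (x + q) / q) ` E_set q \<union> (\<lambda>x. (x + 0) / q) ` E_front q)"
    using a(1) qmap_0_E_set_subset[OF q] by blast
qed

lemma E_front_subset_pieces: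
  assumes q: "q > 1"
  shows "E_front q \<subseteq> (\<lambda>x. (x + 0) / q) ` E_front q \<union> (\<lambda>x. (x + 1) / q) ` E_set q"
  using qmap_0_E_set_subset[OF q] unfolding E_front_def by blast

section \<open>Finite measure at the exponent log golden / log q\<close>

definition golden_dim :: "real \<Rightarrow> real" where
  "golden_dim q = ln golden / ln q"

lemma golden_dim:
  assumes "q > 1"
  shows "golden_dim q > 0" "q powr golden_dim q = golden" "q powr (- golden_dim q) = 1 / golden"
proof -
  show *: "q powr golden_dim q = golden"
    using assms golden_gt by (simp add: golden_dim_def powr_def)
  show "golden_dim q > 0" using assms golden_gt by (simp add: golden_dim_def)
  show "q powr (- golden_dim q) = 1 / golden" by (simp add: powr_minus_divide *)
qed

text \<open>The vector \<open>(golden - 1, 1)\<close> is the Perron eigenvector, with eigenvalue \<open>golden\<close>, of the incidence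
  matrix of the two covering relations above.\<close>

lemma hausdorff_pre_measure_E_set_le:
  assumes q: "q > 1"
  defines "s \<equiv> golden_dim q" and "M \<equiv> q / (q - 1)"
  shows "hausdorff_pre_measure s ((1 / q) ^ n * M) (E_set q) \<le> ennreal ((golden - 1) * M powr s)"
    and "hausdorff_pre_measure s ((1 / q) ^ n * M) (E_front q) \<le> ennreal (M powr s)"
proof (induction n)
  case 0
  have M: "M > 0" using q by (simp add: M_def)
  have "hausdorff_pre_measure s M A \<le> ennreal (M powr s)" if "A \<subseteq> {0..M}" for A
  proof -
    have A: "bounded A" "diameter A \<le> M"
      using that M diameter_subset[OF that] bounded_subset[OF _ that] by auto
    then have "hausdorff_pre_measure s M A \<le> diam_powr s A"
      using M by (intro hausdorff_pre_measure_le_diam_powr) auto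
    also have "\<dots> \<le> ennreal (M powr s)"
      using golden_dim(1)[OF q] A diameter_ge_0[OF A(1)]
      by (auto simp: diam_powr_nonempty s_def intro!: ennreal_leI powr_mono2)
    finally show ?thesis .
  qed
  then have *: "hausdorff_pre_measure s M (E_set q) \<le> ennreal (M powr s)"
    "hausdorff_pre_measure s M (E_front q) \<le> ennreal (M powr s)"
    using E_set_subset[OF q] E_front_subset[OF q] by (auto simp: M_def)
  \<comment> \<open>As golden - 1 \<ge> 1, covers by a single set already satisfy the bounds given
    by the eigenvector.\<close>
  moreover have "ennreal (M powr s) \<le> ennreal ((golden - 1) * M powr s)"
    using golden_gt by (intro ennreal_leI) (simp add: mult_le_cancel_right1)
  ultimately show "hausdorff_pre_measure s ((1 / q) ^ 0 * M) (E_set q) \<le> ennreal ((golden - 1) * M powr s)"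
    and "hausdorff_pre_measure s ((1 / q) ^ 0 * M) (E_front q) \<le> ennreal (M powr s)"
    by (auto intro: order_trans)
next
  case (Suc n)
  let ?\<delta> = "(1 / q) ^ Suc n * M"
  let ?f = "\<lambda>a A. (\<lambda>x. (x + a) / q) ` A"
  have \<delta>: "?\<delta> \<ge> 0" using q by (simp add: M_def)
  have scale: "hausdorff_pre_measure s ?\<delta> (?f a A) \<le> ennreal (c / golden)"
    if "hausdorff_pre_measure s ((1 / q) ^ n * M) A \<le> ennreal c" "c \<ge> 0" for a A c
  proof -
    have "hausdorff_pre_measure s (1 / q * ((1 / q) ^ n * M)) (?f a A)
        \<le> ennreal ((1 / q) powr s) * hausdorff_pre_measure s ((1 / q) ^ n * M) A"
      using q golden_dim(1)[OF q]
      by (intro hausdorff_pre_measure_lipschitz_image)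
        (auto simp: s_def dist_real_def simp flip: diff_divide_distrib)
    also have "(1 / q) powr s = 1 / golden"
      using q golden_dim(3)[OF q] by (simp add: s_def powr_divide powr_minus_divide)
    also have "ennreal (1 / golden) * hausdorff_pre_measure s ((1 / q) ^ n * M) A \<le> ennreal (1 / golden) * ennreal c"
      using that by (intro mult_left_mono) auto
    also have "\<dots> = ennreal (c / golden)" using golden_gt that by (simp flip: ennreal_mult)
    finally show ?thesis by (simp add: mult.assoc)
  qed
  let ?m = "M powr s"
  have nonneg: "0 \<le> ?m" "0 \<le> (golden - 1) * ?m" using golden_gt by auto
  have E: "hausdorff_pre_measure s ?\<delta> (?f a (E_set q)) \<le> ennreal ((golden - 1) * ?m / golden)" for a
    by (rule scale[OF Suc.IH(1) nonneg(2)])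
  have F: "hausdorff_pre_measure s ?\<delta> (?f a (E_front q)) \<le> ennreal (?m / golden)" for a
    by (rule scale[OF Suc.IH(2) nonneg(1)])
  have "hausdorff_pre_measure s ?\<delta> (E_set q) \<le> hausdorff_pre_measure s ?\<delta> (?f 1 (E_set q)) +
      (hausdorff_pre_measure s ?\<delta> (?f q (E_set q)) + hausdorff_pre_measure s ?\<delta> (?f 0 (E_front q)))"
    by (rule order_trans[OF hausdorff_pre_measure_mono[OF E_set_subset_pieces[OF q]]
        order_trans[OF hausdorff_pre_measure_Un_le[OF \<delta>] add_left_mono[OF hausdorff_pre_measure_Un_le[OF \<delta>]]]])
  also have "\<dots> \<le> ennreal ((golden - 1) * ?m / golden) + (ennreal ((golden - 1) * ?m / golden) + ennreal (?m / golden))"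
    by (intro add_mono E F)
  also have "\<dots> = ennreal ((golden - 1) * ?m / golden + ((golden - 1) * ?m / golden + ?m / golden))"
    using golden_gt by (simp flip: ennreal_plus)
  also have "(golden - 1) * ?m / golden + ((golden - 1) * ?m / golden + ?m / golden) = (golden - 1) * ?m"
  proof -
    \<comment> \<open>First row of the eigenvector equation: 2 (golden - 1) + 1 = golden (golden -
      1).\<close>
    have "((golden - 1) + ((golden - 1) + 1)) / golden = golden - 1"
      using golden_gt golden_square by (simp add: field_simps power2_eq_square)
    moreover have "(golden - 1) * ?m / golden + ((golden - 1) * ?m / golden + ?m / golden)
        = ((golden - 1) + ((golden - 1) + 1)) / golden * ?m"
      using golden_gt by (simp add: field_simps)
    ultimately show ?thesis by simp
  qed
  finally show "hausdorff_pre_measure s ?\<delta> (E_set q) \<le> ennreal ((golden - 1) * ?m)" .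
  have "hausdorff_pre_measure s ?\<delta> (E_front q)
      \<le> hausdorff_pre_measure s ?\<delta> (?f 0 (E_front q)) + hausdorff_pre_measure s ?\<delta> (?f 1 (E_set q))"
    by (rule order_trans[OF hausdorff_pre_measure_mono[OF E_front_subset_pieces[OF q]]
        hausdorff_pre_measure_Un_le[OF \<delta>]])
  also have "\<dots> \<le> ennreal (?m / golden) + ennreal ((golden - 1) * ?m / golden)"
    by (intro add_mono E F)
  also have "\<dots> = ennreal (?m / golden + (golden - 1) * ?m / golden)"
    using golden_gt by (simp flip: ennreal_plus)
  also have "?m / golden + (golden - 1) * ?m / golden = ?m"
    using golden_gt by (simp add: field_simps)
  finally show "hausdorff_pre_measure s ?\<delta> (E_front q) \<le> ennreal ?m" .
qed

lemma hausdorff_measure_E_set_finite: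
  assumes q: "q > 1"
  shows "hausdorff_measure (golden_dim q) (E_set q) < \<infinity>"
proof -
  define M where "M = q / (q - 1)"
  have "hausdorff_measure (golden_dim q) (E_set q) \<le> ennreal ((golden - 1) * M powr golden_dim q)"
  proof (rule hausdorff_measure_leI)
    fix \<epsilon> :: real assume "\<epsilon> > 0"
    have "(\<lambda>n. (1 / q) ^ n * M) \<longlonglongrightarrow> 0 * M"
      using q by (intro tendsto_intros LIMSEQ_power_zero) auto
    then have "\<forall>\<^sub>F n in sequentially. (1 / q) ^ n * M < \<epsilon>"
      using \<open>\<epsilon> > 0\<close> by (intro order_tendstoD) auto
    then obtain n where "(1 / q) ^ n * M < \<epsilon>" by (auto simp: eventually_sequentially)
    then show "\<exists>\<delta>\<le>\<epsilon>. hausdorff_pre_measure (golden_dim q) \<delta> (E_set q) \<le> ennreal ((golden - 1) * M powr golden_dim q)"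
      using hausdorff_pre_measure_E_set_le(1)[OF q, of n]
      by (intro exI[of _ "(1 / q) ^ n * M"]) (auto simp: M_def)
  qed
  then show ?thesis by (auto intro: le_less_trans)
qed

section \<open>Unique expansions are null at this exponent\<close>

lemma unique_set_shift:
  assumes q: "q > 1" and x: "q_expansions q x = {d}"
  shows "q_expansions q (q * x - d 0) = {\<lambda>i. d (Suc i)}"
proof -
  have d: "d 0 \<in> {0, 1, q}" "(\<lambda>i. d (Suc i)) \<in> q_expansions q (q * x - d 0)"
    using q_expansions_Suc_iff[OF q, of d x] x by auto
  moreover have "e = (\<lambda>i. d (Suc i))" if "e \<in> q_expansions q (q * x - d 0)" for e
  proof -
    have "case_nat (d 0) e = d" using that d x case_nat_in_q_expansions_iff[OF q, of "d 0" e x] by auto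
    then show ?thesis by (metis nat.case(2) ext)
  qed
  ultimately show ?thesis by blast
qed

definition unique_part :: "real \<Rightarrow> real \<Rightarrow> real set" where
  "unique_part q a = {x. \<exists>d. q_expansions q x = {d} \<and> d 0 = a}"

lemma unique_set_eq_parts:
  "unique_set q = unique_part q 0 \<union> unique_part q 1 \<union> unique_part q q"
proof -
  have "d 0 \<in> {0, 1, q}" if "q_expansions q x = {d}" for d x
  proof -
    have "d \<in> q_expansions q x" using that by simp
    then show ?thesis by (simp add: q_expansions_def)
  qed
  then show ?thesis
    unfolding unique_set_def unique_part_def is_singleton_def by blast
qed

text \<open>Exchanging a leading block 0q or 10 changes the first digit and so produces a second
  expansion. Hence 0 is followed by 0 or 1, and 1 by 1 or q, while q may be followed by any
  digit.\<close>

lemma unique_part_subset: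
  assumes q: "q > 1"
  shows "unique_part q 0 \<subseteq> (\<lambda>x. (x + 0) / q) ` (unique_part q 0 \<union> unique_part q 1)"
    and "unique_part q 1 \<subseteq> (\<lambda>x. (x + 1) / q) ` (unique_part q 1 \<union> unique_part q q)"
    and "unique_part q q \<subseteq> (\<lambda>x. (x + q) / q) ` (unique_part q 0 \<union> (unique_part q 1 \<union> unique_part q q))"
proof -
  have step: "q * x - d 0 \<in> unique_part q (d 1)" "d 1 \<in> {0, 1, q}"
    if "q_expansions q x = {d}" for x d
  proof -
    show "q * x - d 0 \<in> unique_part q (d 1)"
      using unique_set_shift[OF q that] by (auto simp: unique_part_def)
    have "d \<in> q_expansions q x" using that by simp
    then show "d 1 \<in> {0, 1, q}" by (simp add: q_expansions_def)
  qed
  have no: "\<not> (d 0 = 0 \<and> d 1 = q)" "\<not> (d 0 = 1 \<and> d 1 = 0)" if "q_expansions q x = {d}" for x d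
  proof -
    have d: "d = case_nat (d 0) (case_nat (d 1) (\<lambda>i. d (Suc (Suc i))))"
      by (auto simp: fun_eq_iff split: nat.split)
    let ?e = "\<lambda>i. d (Suc (Suc i))"
    have mem: "e \<in> q_expansions q x \<longleftrightarrow> e = d" for e using that by simp
    show "\<not> (d 0 = 0 \<and> d 1 = q)"
    proof
      assume *: "d 0 = 0 \<and> d 1 = q"
      then have "case_nat 1 (case_nat 0 ?e) = d"
        using q_expansions_exchange[OF q, of ?e x] d mem by simp
      then have "d 0 = 1" by (metis nat.case(1))
      then show False using * by simp
    qed
    show "\<not> (d 0 = 1 \<and> d 1 = 0)"
    proof
      assume *: "d 0 = 1 \<and> d 1 = 0"
      then have "case_nat 0 (case_nat q ?e) = d"
        using q_expansions_exchange[OF q, of ?e x] d mem by simp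
      then have "d 0 = 0" by (metis nat.case(1))
      then show False using * by simp
    qed
  qed
  show "unique_part q 0 \<subseteq> (\<lambda>x. (x + 0) / q) ` (unique_part q 0 \<union> unique_part q 1)"
  proof
    fix x assume "x \<in> unique_part q 0"
    then obtain d where d: "q_expansions q x = {d}" "d 0 = 0" by (auto simp: unique_part_def)
    then have "q * x - 0 \<in> unique_part q 0 \<union> unique_part q 1" using step[OF d(1)] no[OF d(1)] by auto
    then show "x \<in> (\<lambda>x. (x + 0) / q) ` (unique_part q 0 \<union> unique_part q 1)" by (rule image_qmapI[OF q])
  qed
  show "unique_part q 1 \<subseteq> (\<lambda>x. (x + 1) / q) ` (unique_part q 1 \<union> unique_part q q)"
  proof
    fix x assume "x \<in> unique_part q 1"
    then obtain d where d: "q_expansions q x = {d}" "d 0 = 1" by (auto simp: unique_part_def)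
    then have "q * x - 1 \<in> unique_part q 1 \<union> unique_part q q" using step[OF d(1)] no[OF d(1)] by auto
    then show "x \<in> (\<lambda>x. (x + 1) / q) ` (unique_part q 1 \<union> unique_part q q)" by (rule image_qmapI[OF q])
  qed
  show "unique_part q q \<subseteq> (\<lambda>x. (x + q) / q) ` (unique_part q 0 \<union> (unique_part q 1 \<union> unique_part q q))"
  proof
    fix x assume "x \<in> unique_part q q"
    then obtain d where d: "q_expansions q x = {d}" "d 0 = q" by (auto simp: unique_part_def)
    then have "q * x - q \<in> unique_part q 0 \<union> (unique_part q 1 \<union> unique_part q q)" using step[OF d(1)] by auto
    then show "x \<in> (\<lambda>x. (x + q) / q) ` (unique_part q 0 \<union> (unique_part q 1 \<union> unique_part q q))"
      by (rule image_qmapI[OF q])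
  qed
qed

text \<open>The admissible successions of digits in a unique expansion have an incidence matrix whose
  spectral radius is below \<open>golden\<close>, the reciprocal of the scaling factor of the measure.\<close>

lemma hausdorff_measure_golden_unique_set:
  assumes q: "q > 1"
  shows "hausdorff_measure (golden_dim q) (unique_set q) = 0"
proof -
  let ?s = "golden_dim q"
  let ?H = "\<lambda>a. hausdorff_measure ?s (unique_part q a)"
  define h where "h a = enn2real (?H a)" for a
  have "unique_part q a \<subseteq> E_set q" for a
    by (auto simp: unique_part_def E_set_def)
  \<comment> \<open>Finiteness is essential: infinite values would satisfy all the inequalities
    below.\<close>
  then have "?H a < \<infinity>" for a
    by (rule le_less_trans[OF hausdorff_measure_mono hausdorff_measure_E_set_finite[OF q]])
  then have H: "?H a = ennreal (h a)" "h a \<ge> 0" for a by (auto simp: h_def)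
  have scale: "hausdorff_measure ?s ((\<lambda>x. (x + a) / q) ` A) \<le> ennreal (1 / golden) * hausdorff_measure ?s A" for a A
    using hausdorff_measure_qmap[OF q golden_dim(1)[OF q]] golden_dim(3)[OF q] by simp
  have le: "h a \<le> r / golden" if "unique_part q a \<subseteq> (\<lambda>x. (x + b) / q) ` A" "hausdorff_measure ?s A \<le> ennreal r" "r \<ge> 0" for a b A r
  proof -
    have "?H a \<le> ennreal (1 / golden) * hausdorff_measure ?s A"
      using hausdorff_measure_mono[OF that(1)] scale order_trans by blast
    also have "\<dots> \<le> ennreal (1 / golden) * ennreal r" using that(2) by (rule mult_left_mono) simp
    also have "\<dots> = ennreal (r / golden)" using golden_gt that(3) by (simp flip: ennreal_mult)
    finally show ?thesis using H[of a] golden_gt that(3) by simp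
  qed
  have H2: "hausdorff_measure ?s (unique_part q a \<union> unique_part q b) \<le> ennreal (h a + h b)" for a b
    using hausdorff_measure_Un_le[of ?s "unique_part q a" "unique_part q b"] H by (simp add: ennreal_plus)
  have H3: "hausdorff_measure ?s (unique_part q a \<union> (unique_part q b \<union> unique_part q c)) \<le> ennreal (h a + (h b + h c))" for a b c
  proof -
    have "hausdorff_measure ?s (unique_part q a \<union> (unique_part q b \<union> unique_part q c))
        \<le> ?H a + hausdorff_measure ?s (unique_part q b \<union> unique_part q c)"
      by (rule hausdorff_measure_Un_le)
    also have "\<dots> \<le> ennreal (h a) + ennreal (h b + h c)"
      unfolding H(1)[of a] by (intro add_left_mono H2)
    also have "\<dots> = ennreal (h a + (h b + h c))" using H(2) by (intro ennreal_plus[symmetric]) auto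
    finally show ?thesis .
  qed
  have mult: "5 / 2 * a \<le> r" if "a \<le> r / golden" "0 \<le> a" for a r
  proof -
    have "5 / 2 * a \<le> golden * a" using golden_gt that by (intro mult_right_mono) auto
    also have "\<dots> \<le> r" using golden_gt that by (simp add: field_simps)
    finally show ?thesis .
  qed
  \<comment> \<open>These give h 0 \<le> 2/3 h 1, h 1 \<le> 2/3 h q and 3/2 h q \<le> h 0 + h 1
    \<le> 10/9 h q, so all three values vanish.\<close>
  have "5 / 2 * h 0 \<le> h 0 + h 1" "5 / 2 * h 1 \<le> h 1 + h q" "5 / 2 * h q \<le> h 0 + (h 1 + h q)"
    by (intro mult[OF le[OF unique_part_subset(1)[OF q] H2]] mult[OF le[OF unique_part_subset(2)[OF q] H2]]
        mult[OF le[OF unique_part_subset(3)[OF q] H3]] H(2) add_nonneg_nonneg)+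
  then have "h 0 = 0" "h 1 = 0" "h q = 0" using H(2)[of 0] H(2)[of 1] H(2)[of q] by linarith+
  then have "hausdorff_measure ?s (unique_part q 0 \<union> (unique_part q 1 \<union> unique_part q q)) \<le> 0"
    using H3[of 0 1 q] by simp
  then show ?thesis by (simp add: unique_set_eq_parts Un_assoc)
qed

section \<open>Positive measure by a change of base\<close>

text \<open>Pairs \<open>(x, y)\<close> sharing a digit sequence, where \<open>x\<close> is read in base \<open>q\<close> and \<open>y\<close> in base \<open>p\<close>;
  the digit \<open>q\<close> of the one corresponds to the digit \<open>p\<close> of the other.\<close>

definition base_change :: "real \<Rightarrow> real \<Rightarrow> (real \<times> real) set" where
  "base_change q p = {(x, y). \<exists>d \<in> q_expansions q x. (\<lambda>i. if d i = q then p else d i) \<in> q_expansions p y}"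

lemma base_change_cases:
  assumes q: "q > 1" and p: "p > 1" and xy: "(x, y) \<in> base_change q p"
  obtains "(q * x, p * y) \<in> base_change q p" | "(q * x - 1, p * y - 1) \<in> base_change q p"
    | "(q * x - q, p * y - p) \<in> base_change q p"
proof -
  obtain d where d: "d \<in> q_expansions q x" "(\<lambda>i. if d i = q then p else d i) \<in> q_expansions p y"
    using xy by (auto simp: base_change_def)
  have d0: "d 0 \<in> {0, 1, q}" using d(1) by (simp add: q_expansions_def)
  have "(q * x - d 0, p * y - (if d 0 = q then p else d 0)) \<in> base_change q p"
    using d q_expansions_Suc_iff[OF q, of d x] q_expansions_Suc_iff[OF p, of "\<lambda>i. if d i = q then p else d i" y]
    unfolding base_change_def by auto
  then show ?thesis using d0 q that by auto
qed

lemma base_change_consI: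
  assumes q: "q > 1" and p: "p > 1"
  shows "(q * x, p * y) \<in> base_change q p \<Longrightarrow> (x, y) \<in> base_change q p"
    and "(q * x - 1, p * y - 1) \<in> base_change q p \<Longrightarrow> (x, y) \<in> base_change q p"
proof -
  have *: "(x, y) \<in> base_change q p" if G: "(q * x - a, p * y - a) \<in> base_change q p" and a: "a \<in> {0, 1}" for a
  proof -
    obtain d where d: "d \<in> q_expansions q (q * x - a)" "(\<lambda>i. if d i = q then p else d i) \<in> q_expansions p (p * y - a)"
      using G by (auto simp: base_change_def)
    have "case_nat a d \<in> q_expansions q x"
      using d(1) a by (auto simp: case_nat_in_q_expansions_iff[OF q])
    moreover have "case_nat a (\<lambda>i. if d i = q then p else d i) \<in> q_expansions p y"
      using d(2) a by (auto simp: case_nat_in_q_expansions_iff[OF p])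
    moreover have "case_nat a (\<lambda>i. if d i = q then p else d i) = (\<lambda>i. if case_nat a d i = q then p else case_nat a d i)"
      using a q by (auto simp: fun_eq_iff split: nat.split)
    ultimately show ?thesis unfolding base_change_def by auto
  qed
  show "(q * x, p * y) \<in> base_change q p \<Longrightarrow> (x, y) \<in> base_change q p" using *[of 0] by simp
  show "(q * x - 1, p * y - 1) \<in> base_change q p \<Longrightarrow> (x, y) \<in> base_change q p" using *[of 1] by simp
qed

lemma base_change_bounds:
  assumes "q > 1" "p > 1" "(x, y) \<in> base_change q p"
  shows "0 \<le> x" "x \<le> q / (q - 1)" "0 \<le> y" "y \<le> p / (p - 1)"
  using assms q_expansions_nonempty_bounds by (auto simp: base_change_def)

text \<open>After exchanging a leading block \<open>0q\<close> for \<open>10\<close>, the three alternatives concern points \<open>x\<close> in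
  intervals that are disjoint for \<open>q > golden\<close>.\<close>

lemma base_change_separated_cases:
  assumes q: "q > 1" and p: "p > 1" and xy: "(x, y) \<in> base_change q p"
  defines "L \<equiv> 1 + q / (q - 1)"
  obtains "(q * x, p * y) \<in> base_change q p" "x \<le> L / q\<^sup>2"
    | "(q * x - 1, p * y - 1) \<in> base_change q p" "1 / q \<le> x" "x \<le> L / q"
    | "(q * x - q, p * y - p) \<in> base_change q p" "1 \<le> x"
proof -
  note cases = that
  have mid: "1 / q \<le> x" "x \<le> L / q" if "(q * x - 1, p * y - 1) \<in> base_change q p"
  proof -
    have "0 \<le> q * x - 1" "q * x - 1 \<le> q / (q - 1)" by (rule base_change_bounds[OF q p that])+
    then have "1 \<le> x * q" "x * q \<le> L" by (simp_all add: L_def mult.commute[of x q])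
    then show "1 / q \<le> x" "x \<le> L / q" using q by (simp_all only: pos_le_divide_eq pos_divide_le_eq less_trans[OF zero_less_one])
  qed
  show ?thesis
  proof (rule base_change_cases[OF q p xy])
    assume B: "(q * x - q, p * y - p) \<in> base_change q p"
    then show ?thesis using cases(3) base_change_bounds(1)[OF q p B] q by simp
  next
    assume B: "(q * x - 1, p * y - 1) \<in> base_change q p"
    then show ?thesis using cases(2) mid by blast
  next
    assume B: "(q * x, p * y) \<in> base_change q p"
    \<comment> \<open>If the digit after a leading 0 is 0 or 1, then q (q x) is at most 1 + q / (q -
      1) = L.\<close>
    have small: "x \<le> L / q\<^sup>2" if "q * (q * x) \<le> L"
      using that q by (simp add: pos_le_divide_eq power2_eq_square mult_ac)
    show ?thesis
    proof (rule base_change_cases[OF q p B])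
      assume C: "(q * (q * x), p * (p * y)) \<in> base_change q p"
      have "q * (q * x) \<le> L" using base_change_bounds(2)[OF q p C] unfolding L_def by linarith
      then show ?thesis using cases(1) B small by blast
    next
      assume C: "(q * (q * x) - 1, p * (p * y) - 1) \<in> base_change q p"
      have "q * (q * x) \<le> L" using base_change_bounds(2)[OF q p C] unfolding L_def by linarith
      then show ?thesis using cases(1) B small by blast
    next
      assume C: "(q * (q * x) - q, p * (p * y) - p) \<in> base_change q p"
      \<comment> \<open>Here q (q x) - q = q (q x - 1), and likewise with p: what follows 0q,
        preceded by a 0, is what follows the digit 1 in 10.\<close>
      have "(q * x - 1, p * y - 1) \<in> base_change q p"
        using C by (simp add: right_diff_distrib base_change_consI(1)[OF q p])
      then show ?thesis using cases(2) mid by blast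
    qed
  qed
qed

text \<open>With L = 1 + q / (q - 1), the pieces lie in [0, L / q^2], [1 / q, L / q] and to the
  right of 1. Both gaps are positive exactly when L < q, that is q < (q - 1)^2.\<close>

lemma above_golden_gap:
  assumes "q > golden"
  shows "1 + q / (q - 1) < q" "0 < 1 / q - (1 + q / (q - 1)) / q\<^sup>2"
proof -
  have q: "q > 1" using assms golden_gt by simp
  then show *: "1 + q / (q - 1) < q"
    using above_golden_iff[OF q] assms by (simp add: field_simps power2_eq_square)
  have "1 / q - L / q\<^sup>2 = (q - L) / q\<^sup>2" for L using q by (simp add: field_simps power2_eq_square)
  then show "0 < 1 / q - (1 + q / (q - 1)) / q\<^sup>2" using * q by simp
qed

text \<open>Points closer than the smallest gap \<kappa> lie in the same piece, so the same leading
  digit can be removed from both. This multiplies distances by q on one side and by p on the other,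
  and the induction continues with n - 1.\<close>

lemma base_change_scale:
  assumes q: "q > golden" "q > 1" and p: "p > 1"
  defines "\<kappa> \<equiv> (1 / q - (1 + q / (q - 1)) / q\<^sup>2)"
  assumes "(x, y) \<in> base_change q p" "(x', y') \<in> base_change q p" "\<bar>x - x'\<bar> < \<kappa> / q ^ n"
  shows "\<bar>y - y'\<bar> \<le> p / (p - 1) / p ^ n"
  using assms(5-)
proof (induction n arbitrary: x y x' y')
  case 0
  then show ?case
    using base_change_bounds[OF q(2) p 0(1)] base_change_bounds[OF q(2) p 0(2)] by auto
next
  case (Suc n)
  let ?G = "base_change q p"
  define L where "L = 1 + q / (q - 1)"
  have \<kappa>: "\<kappa> = 1 / q - L / q\<^sup>2" by (simp add: \<kappa>_def L_def)
  have \<kappa>0: "\<kappa> > 0" unfolding \<kappa>_def by (rule above_golden_gap(2)[OF q(1)])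
  \<comment> \<open>The gap before the third piece is q times the first one, so \<kappa> is the
    smaller of the two.\<close>
  have "q * \<kappa> = 1 - L / q" using q by (simp add: \<kappa> field_simps power2_eq_square)
  then have gap: "\<kappa> \<le> 1 - L / q" using q \<kappa>0 mult_right_mono[of 1 q \<kappa>] by simp
  have "\<kappa> / q ^ Suc n \<le> \<kappa>"
    using \<kappa>0 q one_le_power[of q "Suc n"] by (simp add: pos_divide_le_eq mult_le_cancel_left1 del: power_Suc)
  then have less: "\<bar>x - x'\<bar> < \<kappa>" using Suc.prems(3) by linarith
  have ord: "L / q\<^sup>2 < 1 / q" using \<kappa> \<kappa>0 by simp
  have ord': "1 / q < 1" using q by simp
  have IH: "\<bar>y - y'\<bar> \<le> p / (p - 1) / p ^ Suc n"
    if "(q * x - a, p * y - b) \<in> ?G" "(q * x' - a, p * y' - b) \<in> ?G" for a b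
  proof -
    have "\<bar>(q * x - a) - (q * x' - a)\<bar> = q * \<bar>x - x'\<bar>"
      using q by (simp add: abs_mult flip: right_diff_distrib)
    also have "\<dots> < \<kappa> / q ^ n" using Suc.prems(3) q by (simp add: field_simps)
    finally have "\<bar>(p * y - b) - (p * y' - b)\<bar> \<le> p / (p - 1) / p ^ n"
      by (rule Suc.IH[OF that])
    then have "p * \<bar>y - y'\<bar> \<le> p / (p - 1) / p ^ n"
      using p by (simp add: abs_mult flip: right_diff_distrib)
    then have "\<bar>y - y'\<bar> \<le> p / (p - 1) / p ^ n / p" using p by (simp add: pos_le_divide_eq mult.commute)
    then show ?thesis by (simp add: mult.commute)
  qed
  note cs = base_change_separated_cases[OF q(2) p, folded L_def]
  have "\<exists>a b. (q * x - a, p * y - b) \<in> ?G \<and> (q * x' - a, p * y' - b) \<in> ?G"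
  proof (rule cs[OF Suc.prems(1)])
    assume A: "(q * x, p * y) \<in> ?G" "x \<le> L / q\<^sup>2"
    show ?thesis
    proof (rule cs[OF Suc.prems(2)])
      assume "(q * x', p * y') \<in> ?G" then show ?thesis using A by (intro exI[of _ 0]) simp
    next
      assume "1 / q \<le> x'" then show ?thesis using A less \<kappa> by linarith
    next
      assume "1 \<le> x'" then show ?thesis using A less \<kappa> ord' by linarith
    qed
  next
    assume A: "(q * x - 1, p * y - 1) \<in> ?G" "1 / q \<le> x" "x \<le> L / q"
    show ?thesis
    proof (rule cs[OF Suc.prems(2)])
      assume "x' \<le> L / q\<^sup>2" then show ?thesis using A less \<kappa> by linarith
    next
      assume "(q * x' - 1, p * y' - 1) \<in> ?G" then show ?thesis using A by blast
    next
      assume "1 \<le> x'" then show ?thesis using A less gap by linarith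
    qed
  next
    assume A: "(q * x - q, p * y - p) \<in> ?G" "1 \<le> x"
    show ?thesis
    proof (rule cs[OF Suc.prems(2)])
      assume "x' \<le> L / q\<^sup>2" then show ?thesis using A less \<kappa> ord' by linarith
    next
      assume "x' \<le> L / q" then show ?thesis using A less gap by linarith
    next
      assume "(q * x' - q, p * y' - p) \<in> ?G" then show ?thesis using A by blast
    qed
  qed
  then show ?case using IH by blast
qed

text \<open>Distance below \<kappa> / q^n in base q forces distance at most B / golden^n in base
  golden; as q^s = golden for s = \<open>golden_dim q\<close>, this is a Hoelder estimate of
  exponent s.\<close>

lemma base_change_holder:
  assumes q: "q > golden"
  shows "\<exists>C>0. \<forall>x y x' y'. (x, y) \<in> base_change q golden \<longrightarrow> (x', y') \<in> base_change q golden \<longrightarrow>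
    \<bar>y - y'\<bar> \<le> C * \<bar>x - x'\<bar> powr golden_dim q"
proof -
  let ?s = "golden_dim q"
  have q1: "q > 1" and p1: "golden > 1" using golden_gt q by auto
  define \<kappa> where "\<kappa> = 1 / q - (1 + q / (q - 1)) / q\<^sup>2"
  have \<kappa>0: "\<kappa> > 0" unfolding \<kappa>_def by (rule above_golden_gap(2)[OF q])
  define B where "B = golden / (golden - 1)"
  have B: "B > 0" using p1 by (simp add: B_def)
  \<comment> \<open>Here \<kappa>^s normalises the scales \<kappa> / q^n, and the factor
    \<open>golden\<close> pays for using the scale n - 1 instead of n.\<close>
  define C where "C = B * golden / \<kappa> powr ?s"
  have s: "?s > 0" "q powr ?s = golden" using golden_dim[OF q1] by auto
  have C0: "C > 0" using B p1 \<kappa>0 by (simp add: C_def)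
  have "\<bar>y - y'\<bar> \<le> C * \<bar>x - x'\<bar> powr ?s"
    if G: "(x, y) \<in> base_change q golden" "(x', y') \<in> base_change q golden" for x y x' y'
  proof -
    define t where "t = \<bar>x - x'\<bar>"
    have scale: "\<bar>y - y'\<bar> \<le> B / golden ^ n" if "t < \<kappa> / q ^ n" for n
      using base_change_scale[OF q q1 p1 G, of n] that by (simp add: t_def \<kappa>_def B_def)
    have key: "\<bar>y - y'\<bar> \<le> C * t powr ?s" if "\<kappa> / q ^ n \<le> t" "\<bar>y - y'\<bar> \<le> B * golden / golden ^ n" for n
    proof -
      have "(\<kappa> / q ^ n) powr ?s \<le> t powr ?s"
        using that(1) s(1) \<kappa>0 q1 by (intro powr_mono2) auto
      moreover have "(q ^ n) powr ?s = golden ^ n"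
        using q1 by (simp add: powr_powr mult.commute flip: s(2) powr_realpow)
      then have "(\<kappa> / q ^ n) powr ?s = \<kappa> powr ?s / golden ^ n" by (simp add: powr_divide)
      ultimately have "C * (\<kappa> powr ?s / golden ^ n) \<le> C * t powr ?s"
        using C0 by (intro mult_left_mono) auto
      moreover have "C * (\<kappa> powr ?s / golden ^ n) = B * golden / golden ^ n"
        using \<kappa>0 by (simp add: C_def)
      ultimately show ?thesis using that(2) by linarith
    qed
    show ?thesis
    \<comment> \<open>For t = 0 every scale applies and y = y' follows: different expansions of one
      point reread to the same point.\<close>
    proof (cases "t = 0")
      case True
      have "\<bar>y - y'\<bar> \<le> B / golden ^ n" for n using scale[of n] \<kappa>0 q1 True by simp
      moreover have "(\<lambda>n. B / golden ^ n) \<longlonglongrightarrow> 0" using p1 by real_asymp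
      ultimately have "\<bar>y - y'\<bar> \<le> 0" by (intro LIMSEQ_le_const[of "\<lambda>n. B / golden ^ n"]) auto
      then show ?thesis using True by (simp add: t_def)
    next
      case False
      then have "t > 0" by (simp add: t_def)
      have "(\<lambda>n. \<kappa> / q ^ n) \<longlonglongrightarrow> 0" using q1 by real_asymp
      then have "\<forall>\<^sub>F n in sequentially. \<kappa> / q ^ n < t" using \<open>t > 0\<close> by (intro order_tendstoD)
      then have ex: "\<exists>n. \<kappa> / q ^ n \<le> t" by (auto simp: eventually_sequentially intro: less_imp_le)
      define n where "n = (LEAST n. \<kappa> / q ^ n \<le> t)"
      have n: "\<kappa> / q ^ n \<le> t" unfolding n_def by (rule LeastI_ex[OF ex])
      have "\<bar>y - y'\<bar> \<le> B * golden / golden ^ n"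
      proof (cases n)
        \<comment> \<open>There is no previous scale here; the length B of the whole interval is
          bound enough.\<close>
        case 0
        have "\<bar>y - y'\<bar> \<le> B"
          using base_change_bounds[OF q1 p1 G(1)] base_change_bounds[OF q1 p1 G(2)] by (simp add: B_def)
        also have "B \<le> B * golden" using B p1 by simp
        finally show ?thesis using 0 by simp
      next
        case (Suc k)
        then have "t < \<kappa> / q ^ k" using not_less_Least[of k "\<lambda>n. \<kappa> / q ^ n \<le> t"] by (auto simp: n_def)
        then show ?thesis using scale[of k] Suc p1 by simp
      qed
      then show ?thesis using key[OF n] by (simp add: t_def)
    qed
  qed
  then show ?thesis using C0 by blast
qed

text \<open>Base golden is the extreme case in which the expansions still fill an interval, so the
  reread points have positive length.\<close>

lemma hausdorff_measure_E_set_pos: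
  assumes q: "q > golden"
  shows "hausdorff_measure (golden_dim q) (E_set q) > 0"
proof -
  have q1: "q > 1" and p1: "golden > 1" using golden_gt q by auto
  obtain C where C: "C > 0" "\<And>x y x' y'. (x, y) \<in> base_change q golden \<Longrightarrow> (x', y') \<in> base_change q golden \<Longrightarrow>
    \<bar>y - y'\<bar> \<le> C * \<bar>x - x'\<bar> powr golden_dim q"
    using base_change_holder[OF q] by blast
  have "\<exists>y. (x, y) \<in> base_change q golden" if x: "x \<in> E_set q" for x
  proof -
    obtain d where d: "d \<in> q_expansions q x" using x by (auto simp: E_set_def)
    then have "(if d i = q then golden else d i) \<in> {0, 1, golden}" for i by (auto simp: q_expansions_def)
    then obtain y where "(\<lambda>i. if d i = q then golden else d i) \<in> q_expansions golden y"
      by (rule q_expansions_exI[OF p1])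
    then show ?thesis using d by (auto simp: base_change_def)
  qed
  then obtain g where g: "\<And>x. x \<in> E_set q \<Longrightarrow> (x, g x) \<in> base_change q golden" by metis
  have "ennreal (golden / (golden - 1) - 0) \<le> ennreal C * hausdorff_measure (golden_dim q) (E_set q)"
  proof (rule hausdorff_measure_ge_of_holder)
    show "golden_dim q > 0" by (rule golden_dim(1)[OF q1])
    show "C > 0" by fact
    show "\<bar>g x - g x'\<bar> \<le> C * dist x x' powr golden_dim q" if "x \<in> E_set q" "x' \<in> E_set q" for x x'
      using C(2)[OF g g] that by (simp add: dist_real_def)
    show "{0..golden / (golden - 1)} \<subseteq> g ` E_set q"
    proof
      fix y assume "y \<in> {0..golden / (golden - 1)}"
      then have "y \<in> E_set golden"
        using E_set_eq_interval[OF p1] above_golden_iff[OF p1] by simp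
      then obtain e where e: "e \<in> q_expansions golden y" by (auto simp: E_set_def)
      define d where "d i = (if e i = golden then q else e i)" for i
      have dig: "e i \<in> {0, 1, golden}" for i using e by (simp add: q_expansions_def)
      then have "d i \<in> {0, 1, q}" for i by (auto simp: d_def)
      then obtain x where x: "d \<in> q_expansions q x" by (rule q_expansions_exI[OF q1])
      have "(\<lambda>i. if d i = q then golden else d i) = e"
        using dig q q1 p1 by (force simp: d_def)
      then have xy: "(x, y) \<in> base_change q golden"
        unfolding base_change_def using x e by (simp add: bexI[of _ d])
      have xE: "x \<in> E_set q" using x by (auto simp: E_set_def)
      \<comment> \<open>The choice of \<open>g x\<close> may rest on another expansion of x than d;
        the estimate at distance 0 identifies the two values.\<close>
      have "\<bar>y - g x\<bar> \<le> C * \<bar>x - x\<bar> powr golden_dim q" by (rule C(2)[OF xy g[OF xE]])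
      then show "y \<in> g ` E_set q" using xE by auto
    qed
  qed
  moreover have "golden / (golden - 1) > 0" using p1 by simp
  ultimately show ?thesis by (auto simp: zero_less_iff_neq_zero ennreal_eq_0_iff)
qed

theorem lemma5p5:
  fixes q :: real
  assumes "q > 1"
  shows "hausdorff_measure (hausdorff_dim (E_set q)) (U_continuum q)
           = hausdorff_measure (hausdorff_dim (E_set q)) (E_set q)
         \<and> hausdorff_measure (hausdorff_dim (E_set q)) (E_set q) \<in> {0<..<\<infinity>}"
proof -
  obtain s where s: "s > 0" "hausdorff_measure s (E_set q) \<in> {0<..<\<infinity>}" "hausdorff_measure s (unique_set q) = 0"
  proof (cases "golden < q")
    case True
    then show ?thesis
      using that[of "golden_dim q"] golden_dim(1) hausdorff_measure_E_set_finite hausdorff_measure_E_set_pos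
        hausdorff_measure_golden_unique_set assms by auto
  next
    case False
    then have "(q - 1)\<^sup>2 \<le> q" using above_golden_iff[OF assms] by simp
    then show ?thesis
      using that[of 1] hausdorff_measure_1_E_set hausdorff_measure_1_unique_set assms by auto
  qed
  then show ?thesis
    using hausdorff_dim_eqI[of s "E_set q"] hausdorff_measure_U_continuum_eq[OF assms s(1,3)] by simp
qed

end
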